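(* Let $\mathfrak{a}\in \mathrm{coLie}^{\mathrm{un}}(\mathrm{Vect}^{\mathbb{Z}^m_{\ge 0,+}})$ be a strongly unital $\mathrm{coLie}$-coalgebra. Fix $c_0\in\mathbb{N}$ and $1\le k\le m$, and suppose that there exist $s,s_1,\dots,s_{k-1},s_{k+1},\dots,s_m\in\mathbb{N}$ such that for any non-zero $v\in H^*(\mathrm{Quot}_{\mathrm{un}}(\mathfrak{a}))$ of cohomological degree $c-1\le c_0$ and graded degree $\mathbf{d}\in\mathbb{Z}^m_{\ge 0,+}$ we have $$\mathbf{d}_k\le sc+\sum_{i\ne k}s_i\mathbf{d}_i .$$ Then, for all $c\le c_0$ and $\mathbf{d}\in\mathbb{Z}^m_{\ge 0,+}$ such that $$\mathbf{d}_k\ge sc+\sum_{i\neq k}s_i\mathbf{d}_i,$$ the stabilization map induces an equivalence $$\tau_{\le c}(\mathrm{coChev}^{\mathrm{un}}\mathfrak{a})_{\mathbf{d}}\to\tau_{\le c}(\mathrm{coChev}^{\mathrm{un}}\mathfrak{a})_{\mathbf{d}+\mathbf{1}_k},$$ and an injective map $$H^{c+1}(\mathrm{coChev}^{\mathrm{un}}\mathfrak{a})_{\mathbf{d}}\to H^{c+1}(\mathrm{coChev}^{\mathrm{un}}\mathfrak{a})_{\mathbf{d}+\mathbf{1}_k}.$$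
   Context: $\Lambda$ is a field of characteristic $0$; $\mathrm{Vect}$ is the stable symmetric monoidal $\infty$-category of chain complexes over $\Lambda$, with cohomological indexing; all constructions are derived. Fix $m\ge1$. $\mathbb{Z}^m_{\ge 0,+}=\mathbb{Z}^m_{\ge 0}\setminus\{0\}$; $\mathbf{d}_i$ is the $i$-th coordinate of $\mathbf{d}$; $\mathbf{1}_k=(0,\dots,0,1,0,\dots,0)$ with $1$ in the $k$-th place. $\mathrm{Vect}^{\mathbb{Z}^m_{\ge0,+}}$ and $\mathrm{Vect}^{\mathbb{Z}^m_{\ge0}}$ are the categories of graded objects with Day convolution (graded tensor product). A subscript $\mathbf{d}$ either extracts the component of degree $\mathbf{d}$ or indicates that an object is placed in degree $\mathbf{d}$. Koszul duality: $\mathrm{ComAlg}$ denotes non-unital commutative algebras. $\mathrm{coLie}(\mathrm{Vect}^{\mathbb{Z}^m_{\ge0,+}})$ is the category of coalgebras over the co-operad $\mathrm{coLie}$ (derived, i.e. up to homotopy; linear duals of finite-dimensional ones are dg Lie algebras). Since $\mathrm{Vect}^{\mathbb{Z}^m_{\ge 0,+}}$ is pro-nilpotent there are mutually inverse equivalences $\mathrm{coPrim}[1]:\mathrm{ComAlg}(\mathrm{Vect}^{\mathbb{Z}^m_{\ge0,+}})\rightleftarrows\mathrm{coLie}(\mathrm{Vect}^{\mathbb{Z}^m_{\ge0,+}}):\mathrm{coChev}$, where $\mathrm{coChev}=[-1]\circ\mathrm{coBar}_{\mathrm{coLie}}$ is the cohomological Chevalley complex ($\mathrm{coBar}_{\mathrm{coLie}}$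 being right adjoint to the trivial-coalgebra functor); if $\mathfrak{a}$ has trivial co-bracket, $\mathrm{coChev}\,\mathfrak{a}\simeq\mathrm{Sym}(\mathfrak{a}[-1])_+$, the augmentation ideal of the symmetric algebra. $\mathrm{coChev}^{\mathrm{un}}\mathfrak{a}=\Lambda_{\mathbf{0}}\oplus\mathrm{coChev}\,\mathfrak{a}$ is the unital algebra obtained by adjoining a unit. A unital $\mathrm{coLie}$-coalgebra (an object of $\mathrm{coLie}^{\mathrm{un}}$) is a $\mathrm{coLie}$-coalgebra $\mathfrak{a}$ with a $\mathrm{coLie}$-coalgebra map $\bigoplus_{k=1}^m\Lambda_{\mathbf{1}_k}[1]\to\mathfrak{a}$ (the unit), the source having trivial co-bracket. $\mathrm{Quot}_{\mathrm{un}}(\mathfrak{a})$ is the cofiber (in $\mathrm{coLie}$-coalgebras, equivalently on underlying objects) of the unit map. $\mathfrak{a}$ is strongly unital if it lives in cohomological degrees $\ge-1$ and the unit map induces an isomorphism on $H^{-1}$ (so $\mathrm{Quot}_{\mathrm{un}}(\mathfrak{a})$ lives in degrees $\ge0$). Stabilization maps: applying $\mathrm{coChev}^{\mathrm{un}}$ to the unit gives an algebra map $\Lambda[\mathbb{Z}^m_{\ge0}]=\Lambda[y_1,\dots,y_m]\to\mathrm{coChev}^{\mathrm{un}}\mathfrak{a}$ with $y_k$ in graded degree $\mathbf{1}_k$ and cohomological degree $0$; multiplication by $y_k$ gives maps $(\mathrm{coChev}^{\mathrm{un}}\mathfrak{a})_{\mathbf{d}}\to(\mathrm{coChev}^{\mathrm{un}}\mathfrak{a})_{\mathbf{d}+\mathbf{1}_k}$.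 *)

theory Defs
  imports Complex_Main "HOL-Library.Poly_Mapping" "HOL-Library.Function_Algebras"
    "HOL-Library.Product_Plus"
begin

text \<open>
  A vector space is a subspace of an ambient type carrying a scalar multiplication, so that a
  complex is a family of subspaces \<open>obj C i\<close>.  The values of \<open>dif C i\<close>, and of chain maps, outside
  \<open>obj C i\<close> are irrelevant.
\<close>

record ('k, 'v) cpx =
  obj :: "int \<Rightarrow> 'v set"
  dif :: "int \<Rightarrow> 'v \<Rightarrow> 'v"
  scl :: "'k \<Rightarrow> 'v \<Rightarrow> 'v"

definition linear_map_on ::
  "'v set \<Rightarrow> ('k \<Rightarrow> 'v::ab_group_add \<Rightarrow> 'v) \<Rightarrow> ('k \<Rightarrow> 'w::ab_group_add \<Rightarrow> 'w) \<Rightarrow> ('v \<Rightarrow> 'w) \<Rightarrow> bool"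
  where
  "linear_map_on S s t f \<longleftrightarrow>
     (\<forall>x\<in>S. \<forall>y\<in>S. f (x + y) = f x + f y) \<and> (\<forall>c. \<forall>x\<in>S. f (s c x) = t c (f x))"

definition is_cpx :: "('k::field, 'v::ab_group_add) cpx \<Rightarrow> bool" where
  "is_cpx C \<longleftrightarrow> vector_space (scl C) \<and>
     (\<forall>i. module.subspace (scl C) (obj C i) \<and>
          linear_map_on (obj C i) (scl C) (scl C) (dif C i) \<and>
          dif C i ` obj C i \<subseteq> obj C (i + 1) \<and>
          (\<forall>x\<in>obj C i. dif C (i + 1) (dif C i x) = 0))"

definition chain_map ::
  "('k, 'v::ab_group_add) cpx \<Rightarrow> ('k, 'w::ab_group_add) cpx \<Rightarrow> (int \<Rightarrow> 'v \<Rightarrow> 'w) \<Rightarrow> bool" where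
  "chain_map C D f \<longleftrightarrow>
     (\<forall>i. linear_map_on (obj C i) (scl C) (scl D) (f i) \<and>
          f i ` obj C i \<subseteq> obj D i \<and>
          (\<forall>x\<in>obj C i. f (i + 1) (dif C i x) = dif D i (f i x)))"

definition cocycles :: "('k, 'v::ab_group_add) cpx \<Rightarrow> int \<Rightarrow> 'v set" where
  "cocycles C i = {x \<in> obj C i. dif C i x = 0}"

definition coboundaries :: "('k, 'v::ab_group_add) cpx \<Rightarrow> int \<Rightarrow> 'v set" where
  "coboundaries C i = dif C (i - 1) ` obj C (i - 1)"

definition coh_rel :: "('k, 'v::ab_group_add) cpx \<Rightarrow> int \<Rightarrow> ('v \<times> 'v) set" where
  "coh_rel C i = {(x, y). x \<in> cocycles C i \<and> y \<in> cocycles C i \<and> x - y \<in> coboundaries C i}"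

text \<open>
  Elements of \<open>coh C i\<close> are cosets of the subspace of coboundaries; the zero element is
  \<open>coboundaries C i\<close> itself.
\<close>

definition coh :: "('k, 'v::ab_group_add) cpx \<Rightarrow> int \<Rightarrow> 'v set set" where
  "coh C i = cocycles C i // coh_rel C i"

definition coh_map :: "('k, 'w::ab_group_add) cpx \<Rightarrow> (int \<Rightarrow> 'v \<Rightarrow> 'w) \<Rightarrow> int \<Rightarrow> 'v set \<Rightarrow> 'w set" where
  "coh_map D f i X = coh_rel D i `` (f i ` X)"

text \<open>Equivalences in the derived category: chain maps inducing isomorphisms on cohomology.\<close>

definition quasi_iso ::
  "('k, 'v::ab_group_add) cpx \<Rightarrow> ('k, 'w::ab_group_add) cpx \<Rightarrow> (int \<Rightarrow> 'v \<Rightarrow> 'w) \<Rightarrow> bool" where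
  "quasi_iso C D f \<longleftrightarrow>
     chain_map C D f \<and> (\<forall>i. bij_betw (coh_map D f i) (coh C i) (coh D i))"

definition trunc_le :: "int \<Rightarrow> ('k, 'v::ab_group_add) cpx \<Rightarrow> ('k, 'v) cpx" where
  "trunc_le c C =
     \<lparr>obj = (\<lambda>i. if i < c then obj C i else if i = c then cocycles C c else {0}),
      dif = dif C, scl = scl C\<rparr>"

definition map_cone ::
  "('k, 'v::ab_group_add) cpx \<Rightarrow> ('k, 'w::ab_group_add) cpx \<Rightarrow> (int \<Rightarrow> 'v \<Rightarrow> 'w) \<Rightarrow> ('k, 'v \<times> 'w) cpx"
  where
  "map_cone C D f =
     \<lparr>obj = (\<lambda>i. obj C (i + 1) \<times> obj D i),
      dif = (\<lambda>i (x, y). (- dif C (i + 1) x, f (i + 1) x + dif D i y)),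
      scl = (\<lambda>c (x, y). (scl C c x, scl D c y))\<rparr>"

text \<open>
  The index type \<open>'m\<close> is finite, and multidegrees are functions \<open>'m \<Rightarrow> nat\<close> with pointwise addition.
  An object graded by nonzero multidegrees is a family of complexes of which the member at
  multidegree \<open>0\<close> is ignored throughout.
\<close>

type_synonym 'm mdeg = "'m \<Rightarrow> nat"

type_synonym ('k, 'm, 'v) gcpx = "'m mdeg \<Rightarrow> ('k, 'v) cpx"

definition unit_deg :: "'m \<Rightarrow> 'm mdeg" where
  "unit_deg k = (\<lambda>j. if j = k then 1 else 0)"

text \<open>
  \<open>Sym (X[-1])\<close> is the quotient of the tensor algebra on \<open>X[-1]\<close> by graded commutativity.  It is
  presented by words in homogeneous elements; the letter \<open>(d, i, v)\<close> stands for the element \<open>v\<close> of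
  \<open>X\<close> in multidegree \<open>d\<close> and cohomological degree \<open>i\<close>, hence of degree \<open>i + 1\<close> in \<open>X[-1]\<close>.
\<close>

type_synonym ('m, 'v) letter = "'m mdeg \<times> int \<times> 'v"

definition letters :: "('k, 'm, 'v) gcpx \<Rightarrow> ('m, 'v) letter set" where
  "letters X = {(d, i, v). d \<noteq> 0 \<and> v \<in> obj (X d) i}"

definition words :: "('k, 'm, 'v) gcpx \<Rightarrow> ('m, 'v) letter list set" where
  "words X = lists (letters X)"

definition word_mdeg :: "('m, 'v) letter list \<Rightarrow> 'm mdeg" where
  "word_mdeg w = (\<Sum>(d, i, v)\<leftarrow>w. d)"

definition word_cdeg :: "('m, 'v) letter list \<Rightarrow> int" where
  "word_cdeg w = (\<Sum>(d, i, v)\<leftarrow>w. i + 1)"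

definition koszul_sign :: "int \<Rightarrow> 'r::ring_1" where
  "koszul_sign n = (if even n then 1 else -1)"

definition pm_scale :: "'k::field \<Rightarrow> ('x \<Rightarrow>\<^sub>0 'k) \<Rightarrow> ('x \<Rightarrow>\<^sub>0 'k)" where
  "pm_scale c = Poly_Mapping.map ((*) c)"

text \<open>
  Multilinearity relations (making words into tensors) and graded commutativity relations, in the
  vector space with basis the words.
\<close>

inductive_set sym_rels ::
  "('k::field, 'm, 'v::ab_group_add) gcpx \<Rightarrow> (('m, 'v) letter list \<Rightarrow>\<^sub>0 'k) set"
  for X :: "('k, 'm, 'v) gcpx" where
  add: "\<lbrakk>xs \<in> words X; ys \<in> words X; (d, i, u) \<in> letters X; (d, i, v) \<in> letters X\<rbrakk> \<Longrightarrow>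
    Poly_Mapping.single (xs @ [(d, i, u + v)] @ ys) 1
      - Poly_Mapping.single (xs @ [(d, i, u)] @ ys) 1
      - Poly_Mapping.single (xs @ [(d, i, v)] @ ys) 1 \<in> sym_rels X"
| scale: "\<lbrakk>xs \<in> words X; ys \<in> words X; (d, i, v) \<in> letters X\<rbrakk> \<Longrightarrow>
    Poly_Mapping.single (xs @ [(d, i, scl (X d) c v)] @ ys) 1
      - Poly_Mapping.single (xs @ [(d, i, v)] @ ys) c \<in> sym_rels X"
| comm: "\<lbrakk>xs \<in> words X; ys \<in> words X; (d, i, u) \<in> letters X; (e, j, v) \<in> letters X\<rbrakk> \<Longrightarrow>
    Poly_Mapping.single (xs @ [(d, i, u), (e, j, v)] @ ys) 1
      - Poly_Mapping.single (xs @ [(e, j, v), (d, i, u)] @ ys)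
          (koszul_sign ((i + 1) * (j + 1))) \<in> sym_rels X"

definition word_prod :: "('m mdeg \<Rightarrow> int \<Rightarrow> 'v \<Rightarrow> 'a::ring_1) \<Rightarrow> ('m, 'v) letter list \<Rightarrow> 'a" where
  "word_prod \<iota> w = (\<Prod>(d, i, v)\<leftarrow>w. \<iota> d i v)"

text \<open>
  The algebra \<open>'a\<close>, with scalar multiplication \<open>s\<close> and the maps \<open>\<iota> d i\<close> from \<open>X\<close> (of degree \<open>1\<close>), is a
  symmetric algebra \<open>Sym (X[-1])\<close>: evaluation of words identifies \<open>'a\<close> with the span of words modulo
  the span of the relations.
\<close>

definition is_symmetric_algebra ::
  "('k::field, 'm, 'v::ab_group_add) gcpx \<Rightarrow> ('k \<Rightarrow> 'a::ring_1 \<Rightarrow> 'a)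
    \<Rightarrow> ('m mdeg \<Rightarrow> int \<Rightarrow> 'v \<Rightarrow> 'a) \<Rightarrow> bool" where
  "is_symmetric_algebra X s \<iota> \<longleftrightarrow>
     vector_space s \<and>
     (\<forall>c x y. s c (x * y) = s c x * y \<and> s c (x * y) = x * s c y) \<and>
     module.span s (word_prod \<iota> ` words X) = UNIV \<and>
     (\<forall>f. Poly_Mapping.keys f \<subseteq> words X \<longrightarrow>
        ((\<Sum>w\<in>Poly_Mapping.keys f. s (Poly_Mapping.lookup f w) (word_prod \<iota> w)) = 0
          \<longleftrightarrow> f \<in> module.span pm_scale (sym_rels X)))"

text \<open>
  A coLie-coalgebra (up to homotopy, i.e. an \<open>L\<^sub>\<infinity>\<close>-coalgebra) \<open>\<aa>\<close> consists of a graded complex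
  \<open>und \<aa>\<close> and a square-zero derivation \<open>codif \<aa>\<close> of degree \<open>1\<close> on the symmetric algebra of
  \<open>und \<aa>[-1]\<close>, whose linear part is the differential of \<open>und \<aa>[-1]\<close>, i.e. minus that of \<open>und \<aa>\<close>.  The
  component of \<open>codif \<aa>\<close> from \<open>und \<aa>[-1]\<close> to its \<open>n\<close>-th symmetric power is the \<open>n\<close>-ary co-bracket, and
  \<open>codif \<aa> \<circ> codif \<aa> = 0\<close> comprises all (higher) co-Jacobi identities.  Since all multidegrees are
  nonzero, only finitely many co-brackets are nonzero on a given element.  The symmetric algebra is
  the type \<open>'a\<close> with scalar multiplication \<open>smul \<aa>\<close> and structure maps \<open>incl \<aa>\<close>.  As all
  multidegrees are nonzero and the characteristic is \<open>0\<close>, these quasi-free algebras are cofibrant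
  and represent all objects and maps of the \<open>\<infinity>\<close>-category of coLie-coalgebras.
\<close>

record ('k, 'm, 'v, 'a) coLie =
  und :: "('k, 'm, 'v) gcpx"
  smul :: "'k \<Rightarrow> 'a \<Rightarrow> 'a"
  incl :: "'m mdeg \<Rightarrow> int \<Rightarrow> 'v \<Rightarrow> 'a"
  codif :: "'a \<Rightarrow> 'a"

definition sym_part ::
  "('k::field, 'm, 'v, 'a::ring_1) coLie \<Rightarrow> 'm mdeg \<Rightarrow> int \<Rightarrow> 'a set" where
  "sym_part \<aa> d n =
     module.span (smul \<aa>)
       (word_prod (incl \<aa>) ` {w \<in> words (und \<aa>). word_mdeg w = d \<and> word_cdeg w = n})"

definition decomposables ::
  "('k::field, 'm, 'v, 'a::ring_1) coLie \<Rightarrow> 'm mdeg \<Rightarrow> int \<Rightarrow> 'a set" where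
  "decomposables \<aa> d n =
     module.span (smul \<aa>)
       (word_prod (incl \<aa>) `
         {w \<in> words (und \<aa>). 2 \<le> length w \<and> word_mdeg w = d \<and> word_cdeg w = n})"

definition is_coLie :: "('k::field, 'm, 'v::ab_group_add, 'a::ring_1) coLie \<Rightarrow> bool" where
  "is_coLie \<aa> \<longleftrightarrow>
     (\<forall>d. d \<noteq> 0 \<longrightarrow> is_cpx (und \<aa> d)) \<and>
     is_symmetric_algebra (und \<aa>) (smul \<aa>) (incl \<aa>) \<and>
     Vector_Spaces.linear (smul \<aa>) (smul \<aa>) (codif \<aa>) \<and>
     (\<forall>d n. codif \<aa> ` sym_part \<aa> d n \<subseteq> sym_part \<aa> d (n + 1)) \<and>
     (\<forall>d n. \<forall>x\<in>sym_part \<aa> d n. \<forall>y.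
        codif \<aa> (x * y) = codif \<aa> x * y + koszul_sign n * (x * codif \<aa> y)) \<and>
     (\<forall>x. codif \<aa> (codif \<aa> x) = 0) \<and>
     (\<forall>d i v. (d, i, v) \<in> letters (und \<aa>) \<longrightarrow>
        codif \<aa> (incl \<aa> d i v) + incl \<aa> d (i + 1) (dif (und \<aa> d) i v) \<in> decomposables \<aa> d (i + 2))"

definition coChev_un ::
  "('k::field, 'm, 'v, 'a::ring_1) coLie \<Rightarrow> ('k, 'm, 'a) gcpx" where
  "coChev_un \<aa> d = \<lparr>obj = sym_part \<aa> d, dif = (\<lambda>_. codif \<aa>), scl = smul \<aa>\<rparr>"

text \<open>
  A map of coLie-coalgebras (up to homotopy) is a map \<open>\<Phi>\<close> of unital differential graded algebras
  between the unital cochain algebras \<open>coChev_un\<close>; \<open>\<phi>\<close> is its linear part, the underlying map of complexes.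
\<close>

definition coLie_map ::
  "('k::field, 'm, 'v::ab_group_add, 'a::ring_1) coLie \<Rightarrow> ('k, 'm, 'w::ab_group_add, 'b::ring_1) coLie
    \<Rightarrow> ('m mdeg \<Rightarrow> int \<Rightarrow> 'v \<Rightarrow> 'w) \<Rightarrow> ('a \<Rightarrow> 'b) \<Rightarrow> bool" where
  "coLie_map \<aa> \<bb> \<phi> \<Phi> \<longleftrightarrow>
     (\<forall>d. chain_map (coChev_un \<aa> d) (coChev_un \<bb> d) (\<lambda>_. \<Phi>)) \<and>
     Vector_Spaces.linear (smul \<aa>) (smul \<bb>) \<Phi> \<and> \<Phi> 1 = 1 \<and> (\<forall>x y. \<Phi> (x * y) = \<Phi> x * \<Phi> y) \<and>
     (\<forall>d. d \<noteq> 0 \<longrightarrow> chain_map (und \<aa> d) (und \<bb> d) (\<phi> d)) \<and>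
     (\<forall>d i v. (d, i, v) \<in> letters (und \<aa>) \<longrightarrow>
        \<Phi> (incl \<aa> d i v) - incl \<bb> d i (\<phi> d i v) \<in> decomposables \<bb> d (i + 1))"

text \<open>
  The source of the unit, the sum of the one-dimensional trivial coLie-coalgebras placed in
  multidegree \<open>unit_deg k\<close> and cohomological degree \<open>-1\<close>.  Elements of the sum are coordinate vectors
  \<open>'m \<Rightarrow> 'k\<close>.  The shifted generators are in degree \<open>0\<close>, so the symmetric algebra is the monoid
  algebra of \<open>'m mdeg\<close>, the polynomial ring in the variables \<open>y_var k\<close>; triviality of the co-bracket
  means that its differential is zero.
\<close>

definition y_var :: "'m \<Rightarrow> ('m mdeg \<Rightarrow>\<^sub>0 'k::field)" where
  "y_var k = Poly_Mapping.single (unit_deg k) 1"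

definition unit_cpx :: "('k::field, 'm, 'm \<Rightarrow> 'k) gcpx" where
  "unit_cpx d =
     \<lparr>obj = (\<lambda>i. if i = -1 then {u. \<forall>k. d \<noteq> unit_deg k \<longrightarrow> u k = 0} else {0}),
      dif = (\<lambda>_ _. 0), scl = (\<lambda>c u k. c * u k)\<rparr>"

definition unit_coLie :: "('k::field, 'm::finite, 'm \<Rightarrow> 'k, 'm mdeg \<Rightarrow>\<^sub>0 'k) coLie" where
  "unit_coLie =
     \<lparr>und = unit_cpx, smul = pm_scale, incl = (\<lambda>d i u. \<Sum>k\<in>UNIV. pm_scale (u k) (y_var k)),
      codif = (\<lambda>_. 0)\<rparr>"

definition is_unital_coLie ::
  "('k::field, 'm::finite, 'v::ab_group_add, 'a::ring_1) coLie
    \<Rightarrow> ('m mdeg \<Rightarrow> int \<Rightarrow> ('m \<Rightarrow> 'k) \<Rightarrow> 'v) \<Rightarrow> (('m mdeg \<Rightarrow>\<^sub>0 'k) \<Rightarrow> 'a) \<Rightarrow> bool" where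
  "is_unital_coLie \<aa> \<eta> \<Phi> \<longleftrightarrow> is_coLie \<aa> \<and> coLie_map unit_coLie \<aa> \<eta> \<Phi>"

definition Quot_un ::
  "('k::field, 'm::finite, 'v::ab_group_add, 'a::ring_1) coLie
    \<Rightarrow> ('m mdeg \<Rightarrow> int \<Rightarrow> ('m \<Rightarrow> 'k) \<Rightarrow> 'v) \<Rightarrow> ('k, 'm, ('m \<Rightarrow> 'k) \<times> 'v) gcpx" where
  "Quot_un \<aa> \<eta> d = map_cone (und unit_coLie d) (und \<aa> d) (\<eta> d)"

definition strongly_unital ::
  "('k::field, 'm::finite, 'v::ab_group_add, 'a::ring_1) coLie
    \<Rightarrow> ('m mdeg \<Rightarrow> int \<Rightarrow> ('m \<Rightarrow> 'k) \<Rightarrow> 'v) \<Rightarrow> bool" where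
  "strongly_unital \<aa> \<eta> \<longleftrightarrow>
     (\<forall>d. d \<noteq> 0 \<longrightarrow>
        (\<forall>i < -1. coh (und \<aa> d) i = {coboundaries (und \<aa> d) i}) \<and>
        bij_betw (coh_map (und \<aa> d) (\<eta> d) (-1)) (coh (und unit_coLie d) (-1)) (coh (und \<aa> d) (-1)))"

text \<open>
  The algebra map \<open>\<Phi>\<close> is the effect of \<open>coChev_un\<close> on the unit.
\<close>

definition stabilization ::
  "(('m mdeg \<Rightarrow>\<^sub>0 'k::field) \<Rightarrow> 'a::ring_1) \<Rightarrow> 'm \<Rightarrow> int \<Rightarrow> 'a \<Rightarrow> 'a" where
  "stabilization \<Phi> k i x = \<Phi> (y_var k) * x"

end

theory Submission
  imports Defs
begin

text \<open>
  Let \<open>A\<close> be the unital Chevalley algebra of \<open>\<aa>\<close>, with differential \<open>\<delta>\<close>, and let \<open>y\<close> be the image of the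
  variable \<open>y_var k\<close>.  No product of two letters has multidegree \<open>unit_deg k\<close>, so \<open>y\<close> is a single
  letter; it has cohomological degree \<open>0\<close>, is central, a cocycle, and not a zero divisor.  The long
  exact sequence of \<open>0 \<longrightarrow> A \<longrightarrow> A \<longrightarrow> A/yA \<longrightarrow> 0\<close> therefore reduces the theorem to the vanishing of
  \<open>H\<^sup>n(A/yA)\<close> in multidegree \<open>d + unit_deg k\<close> for \<open>n \<le> c\<close>; concretely, an element whose differential
  lies in \<open>yA\<close> must itself lie in \<open>yA + \<delta>A\<close> (\<open>cocycle_mod_y_is_boundary_mod_y_in_range\<close>).

  The bound behind this vanishing is additive.  Filtering \<open>A\<close> by word length, one expects the
  cohomology of \<open>A/yA\<close> to be made of products of classes of \<open>\<aa>[-1]\<close> other than \<open>y\<close>.  Such a class is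
  either another variable \<open>y_var j\<close>, of cohomological degree \<open>0\<close> and with \<open>k\<close>-th multidegree \<open>0\<close>, or it
  comes from the quotient by the unit; in both cases its degrees \<open>n \<ge> 0\<close> and \<open>d\<close> satisfy
  \<open>d k \<le> s n + \<Sum> t i d i\<close>, and so do those of a product.  In the range of the theorem, multidegree
  \<open>d + unit_deg k\<close> violates the inequality, so every product of classes in it has a factor \<open>y\<close>
  (\<open>harmonic_word_in_y_multiples\<close>).

  Instead of a spectral sequence and the cohomology of symmetric powers, a Hodge argument is used.
  Contract each complex \<open>und \<aa> d\<close> onto representatives of its cohomology (\<open>contraction_exists\<close>),
  with the unit class among them, and extend the contracting homotopy to a derivation \<open>\<theta>\<close> of \<open>A\<close> of
  degree \<open>-1\<close>.  The Laplacian \<open>\<delta>\<theta> + \<theta>\<delta>\<close> is a derivation of degree \<open>0\<close>.  Modulo longer words, it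
  multiplies a word by the number of its letters that are not representatives
  (\<open>laplacian_pure_word\<close>), while it maps cocycles modulo \<open>yA\<close> into \<open>yA + \<delta>A\<close>, because \<open>\<theta> y = 0\<close>.  In
  characteristic \<open>0\<close> the nonzero eigenvalues can be inverted, so that only words in the
  representatives remain, and these are multiples of \<open>y\<close>
  (\<open>cocycle_mod_y_is_boundary_mod_y\<close>).
\<close>

section \<open>Cochain complexes and contractions\<close>

text \<open>
  A part \<open>K\<close> of the complement is prescribed because the class of the unit must belong to the chosen
  representatives of cohomology.
\<close>

lemma (in vector_space) complement_exists:
  assumes U: "subspace U" and W: "subspace W" "U \<subseteq> W"
    and K: "subspace K" "K \<subseteq> W" "K \<inter> U \<subseteq> {0}"
  shows "\<exists>C. subspace C \<and> K \<subseteq> C \<and> C \<subseteq> W \<and> C \<inter> U \<subseteq> {0} \<and> (\<forall>w\<in>W. \<exists>u\<in>U. \<exists>c\<in>C. w = u + c)"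
proof -
  interpret vector_space_pair scale scale ..
  let ?V = "{u + k |u k. u \<in> U \<and> k \<in> K}"
  have V: "subspace ?V" using U K by (intro subspace_sums)
  obtain p where p: "range p \<subseteq> ?V" "Vector_Spaces.linear scale scale p" "\<And>v. v \<in> ?V \<Longrightarrow> p v = v"
    using linear_exists_left_inverse_on[OF linear_id V, unfolded id_def] by auto
  interpret p: Vector_Spaces.linear scale scale p by (rule p)
  have VW: "?V \<subseteq> W" using U W K by (auto intro: subspace_add)
  \<comment> \<open>The kernel of the projection \<open>p\<close> is a complement of \<open>U + K\<close>, to which \<open>K\<close> is added back.\<close>
  let ?C = "{k + c |k c. k \<in> K \<and> c \<in> {x \<in> W. p x = 0}}"
  have P: "subspace {x \<in> W. p x = 0}"
    using subspace_inter[OF W(1) p.subspace_kernel] by (simp add: Int_def)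
  show ?thesis
  proof (intro exI[of _ ?C] conjI ballI)
    show "subspace ?C" by (rule subspace_sums[OF K(1) P])
    show "K \<subseteq> ?C" using subspace_0[OF P] by force
    show "?C \<subseteq> W" using K W by (auto intro: subspace_add)
    show "?C \<inter> U \<subseteq> {0}"
    proof
      fix x assume "x \<in> ?C \<inter> U"
      then obtain k c where x: "x = k + c" "k \<in> K" "p c = 0" "x \<in> U" by auto
      have "0 + k \<in> ?V" "x + 0 \<in> ?V" using x subspace_0[OF U] subspace_0[OF K(1)] by blast+
      then have "k \<in> ?V" "x \<in> ?V" by simp_all
      then have "p k = k" "p x = x" using p(3) by blast+
      moreover have "p x = p k" using x(1,3) by (simp add: p.add)
      ultimately have "x = k" by simp
      then show "x \<in> {0}" using x K by auto
    qed
    fix w assume w: "w \<in> W"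
    have "p w \<in> ?V" by (rule subsetD[OF p(1) rangeI])
    then obtain u k where uk: "p w = u + k" "u \<in> U" "k \<in> K" by auto
    have "p (w - p w) = 0" using p(3)[OF \<open>p w \<in> ?V\<close>] by (simp add: p.diff)
    moreover have "w - p w \<in> W" using w \<open>p w \<in> ?V\<close> VW W by (blast intro: subspace_diff)
    ultimately have "k + (w - p w) \<in> ?C" using uk by blast
    moreover have "w = u + (k + (w - p w))" using uk by (simp add: algebra_simps)
    ultimately show "\<exists>u\<in>U. \<exists>c\<in>?C. w = u + c" using uk by blast
  qed
qed

lemma linear_map_on_subset: "linear_map_on S s t f \<Longrightarrow> T \<subseteq> S \<Longrightarrow> linear_map_on T s t f"
  by (auto simp: linear_map_on_def subset_eq)

locale cochain_complex =
  fixes C :: "('k::field, 'v::ab_group_add) cpx"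
  assumes cpx: "is_cpx C"
begin

sublocale vector_space "scl C"
  using cpx by (simp add: is_cpx_def)

lemma subspace_obj: "subspace (obj C i)"
  and dif_obj: "x \<in> obj C i \<Longrightarrow> dif C i x \<in> obj C (i + 1)"
  and dif_dif: "x \<in> obj C i \<Longrightarrow> dif C (i + 1) (dif C i x) = 0"
  using cpx by (auto simp: is_cpx_def)

lemma dif_add: "x \<in> obj C i \<Longrightarrow> y \<in> obj C i \<Longrightarrow> dif C i (x + y) = dif C i x + dif C i y"
  and dif_scale: "x \<in> obj C i \<Longrightarrow> dif C i (scl C c x) = scl C c (dif C i x)"
  using cpx by (auto simp: is_cpx_def linear_map_on_def)

lemma zero_obj [simp]: "0 \<in> obj C i"
  by (rule subspace_0[OF subspace_obj])

lemma linear_map_on_0: "linear_map_on (obj C i) (scl C) t f \<Longrightarrow> f 0 = 0"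
  unfolding linear_map_on_def by (metis add_cancel_right_left zero_obj)

lemma dif_0 [simp]: "dif C i 0 = 0"
  using dif_add[of 0 i 0] by simp

lemma subspace_cocycles: "subspace (cocycles C i)"
  by (rule subspaceI)
    (auto simp: cocycles_def dif_add dif_scale subspace_add subspace_scale subspace_obj)

lemma subspace_coboundaries: "subspace (coboundaries C i)"
proof (rule subspaceI)
  show "0 \<in> coboundaries C i" unfolding coboundaries_def using dif_0 zero_obj by (metis imageI)
  show "x + y \<in> coboundaries C i" if "x \<in> coboundaries C i" "y \<in> coboundaries C i" for x y
    using that unfolding coboundaries_def
    by (auto simp flip: dif_add intro!: imageI simp: subspace_add subspace_obj)
  show "scl C c x \<in> coboundaries C i" if "x \<in> coboundaries C i" for x c
    using that unfolding coboundaries_def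
    by (auto simp flip: dif_scale intro!: imageI simp: subspace_scale subspace_obj)
qed

lemma coboundaries_cocycles: "coboundaries C i \<subseteq> cocycles C i"
  using dif_obj[of _ "i - 1"] dif_dif[of _ "i - 1"] by (auto simp: coboundaries_def cocycles_def)

lemma cocycles_obj: "cocycles C i \<subseteq> obj C i"
  by (auto simp: cocycles_def)

lemma equiv_coh_rel: "equiv (cocycles C i) (coh_rel C i)"
proof (rule equivI)
  show "coh_rel C i \<subseteq> cocycles C i \<times> cocycles C i" by (auto simp: coh_rel_def)
  show "refl_on (cocycles C i) (coh_rel C i)"
    by (rule refl_onI) (auto simp: coh_rel_def subspace_0 subspace_coboundaries)
  show "sym (coh_rel C i)"
    by (rule symI) (use subspace_neg[OF subspace_coboundaries] in \<open>fastforce simp: coh_rel_def\<close>)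
  show "trans (coh_rel C i)"
    by (rule transI) (use subspace_add[OF subspace_coboundaries] in \<open>fastforce simp: coh_rel_def\<close>)
qed

lemma coh_class_eq_iff:
  assumes "x \<in> cocycles C i" "y \<in> cocycles C i"
  shows "coh_rel C i `` {x} = coh_rel C i `` {y} \<longleftrightarrow> x - y \<in> coboundaries C i"
  using eq_equiv_class_iff[OF equiv_coh_rel assms] assms by (simp add: coh_rel_def)

lemma coh_eq: "coh C i = (\<lambda>x. coh_rel C i `` {x}) ` cocycles C i"
  by (auto simp: coh_def quotient_def)

lemma coh_zero_class: "coh_rel C i `` {0} = coboundaries C i"
  using coboundaries_cocycles subspace_neg[OF subspace_coboundaries] subspace_0[OF subspace_cocycles]
  by (fastforce simp: coh_rel_def)

lemma coh_class_eq_0_iff: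
  "x \<in> cocycles C i \<Longrightarrow> coh_rel C i `` {x} = coboundaries C i \<longleftrightarrow> x \<in> coboundaries C i"
  using coh_class_eq_iff[of x i 0] subspace_0[OF subspace_cocycles] by (simp add: coh_zero_class)

lemma coh_eq_0D:
  assumes "coh C i = {coboundaries C i}" and x: "x \<in> cocycles C i"
  shows "x \<in> coboundaries C i"
proof -
  have "coh_rel C i `` {x} \<in> coh C i"
    unfolding coh_eq using x by (rule imageI)
  then have "coh_rel C i `` {x} = coboundaries C i"
    using assms(1) by simp
  then show ?thesis
    using coh_class_eq_0_iff[OF x] by simp
qed

text \<open>
  A homotopy \<open>\<sigma>\<close> that contracts the complex onto representatives \<open>H\<close> of its cohomology: the operator
  \<open>dif \<circ> \<sigma> + \<sigma> \<circ> dif\<close> is the projection to \<open>A\<close> along \<open>H\<close>.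
\<close>

definition contraction :: "(int \<Rightarrow> 'v set) \<Rightarrow> (int \<Rightarrow> 'v set) \<Rightarrow> (int \<Rightarrow> 'v \<Rightarrow> 'v) \<Rightarrow> bool" where
  "contraction H A \<sigma> \<longleftrightarrow> (\<forall>i.
     subspace (H i) \<and> H i \<subseteq> cocycles C i \<and> H i \<inter> coboundaries C i \<subseteq> {0} \<and>
     A i \<subseteq> obj C i \<and> (\<forall>x\<in>obj C i. \<exists>h\<in>H i. \<exists>a\<in>A i. x = h + a) \<and>
     linear_map_on (obj C i) (scl C) (scl C) (\<sigma> i) \<and> \<sigma> i ` obj C i \<subseteq> obj C (i - 1) \<and>
     (\<forall>h\<in>H i. \<sigma> i h = 0) \<and>
     (\<forall>a\<in>A i. dif C (i - 1) (\<sigma> i a) + \<sigma> (i + 1) (dif C i a) = a))"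

text \<open>
  If \<open>D\<close> is a complement of the cocycles and \<open>H\<close> a complement of the coboundaries in the cocycles,
  then \<open>obj C i = dif (D (i - 1)) \<oplus> H i \<oplus> D i\<close> and \<open>dif\<close> is injective on \<open>D\<close>.  The homotopy inverts \<open>dif\<close>
  on the first summand and vanishes on the others; \<open>A\<close> is the sum of the first and the third.
\<close>

lemma contraction_exists:
  assumes K: "\<And>i. subspace (K i)" "\<And>i. K i \<subseteq> cocycles C i" "\<And>i. K i \<inter> coboundaries C i \<subseteq> {0}"
  shows "\<exists>H A \<sigma>. contraction H A \<sigma> \<and> (\<forall>i. K i \<subseteq> H i)"
proof -
  let ?Z = "cocycles C" and ?B = "coboundaries C"
  note obj = subspace_obj and Z = subspace_cocycles and B = subspace_coboundaries
    and BZ = coboundaries_cocycles and ZO = cocycles_obj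
  have "\<exists>H. subspace H \<and> K i \<subseteq> H \<and> H \<subseteq> ?Z i \<and> H \<inter> ?B i \<subseteq> {0} \<and> (\<forall>z\<in>?Z i. \<exists>b\<in>?B i. \<exists>h\<in>H. z = b + h)" for i
    by (rule complement_exists) (use B Z BZ K in auto)
  then obtain H where H: "\<And>i. subspace (H i)" "\<And>i. K i \<subseteq> H i" "\<And>i. H i \<subseteq> ?Z i" "\<And>i. H i \<inter> ?B i \<subseteq> {0}"
    "\<And>i z. z \<in> ?Z i \<Longrightarrow> \<exists>b\<in>?B i. \<exists>h\<in>H i. z = b + h"
    by metis
  have "\<exists>D. subspace D \<and> {0} \<subseteq> D \<and> D \<subseteq> obj C i \<and> D \<inter> ?Z i \<subseteq> {0} \<and> (\<forall>x\<in>obj C i. \<exists>z\<in>?Z i. \<exists>c\<in>D. x = z + c)" for i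
    by (rule complement_exists) (use Z ZO obj subspace_0 in auto)
  then obtain D where D: "\<And>i. subspace (D i)" "\<And>i. D i \<subseteq> obj C i" "\<And>i. D i \<inter> ?Z i \<subseteq> {0}"
    "\<And>i x. x \<in> obj C i \<Longrightarrow> \<exists>z\<in>?Z i. \<exists>c\<in>D i. x = z + c"
    by metis
  \<comment> \<open>\<open>dec i x c h c'\<close>: the components of \<open>x\<close> are \<open>dif C (i - 1) c\<close>, \<open>h\<close> and \<open>c'\<close>.\<close>
  define dec where "dec i x c h c' \<longleftrightarrow> c \<in> D (i - 1) \<and> h \<in> H i \<and> c' \<in> D i \<and> x = dif C (i - 1) c + h + c'"
    for i x c h c'
  have dec_ex: "\<exists>c h c'. dec i x c h c'" if x: "x \<in> obj C i" for i x
  proof -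
    obtain z c' where z: "z \<in> ?Z i" "c' \<in> D i" "x = z + c'" using D(4)[OF x] by blast
    obtain b h where b: "b \<in> ?B i" "h \<in> H i" "z = b + h" using H(5)[OF z(1)] by blast
    obtain x' where x': "x' \<in> obj C (i - 1)" "b = dif C (i - 1) x'" using b(1) by (auto simp: coboundaries_def)
    obtain z'' c where c: "z'' \<in> ?Z (i - 1)" "c \<in> D (i - 1)" "x' = z'' + c" using D(4)[OF x'(1)] by blast
    have "b = dif C (i - 1) c"
      using c x' D(2) by (auto simp: cocycles_def dif_add subset_eq)
    then show ?thesis using z b c by (auto simp: dec_def)
  qed
  have dec_add: "dec i (x + y) (c + d) (h + k) (c' + d')" if "dec i x c h c'" "dec i y d k d'" for i x y c d h k c' d'
    using that D(2)[of "i - 1"] unfolding dec_def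
    by (auto simp: dif_add subset_eq intro: subspace_add D(1) H(1))
  have dec_scale: "dec i (scl C r x) (scl C r c) (scl C r h) (scl C r c')" if "dec i x c h c'" for i x c h c' r
    using that D(2)[of "i - 1"] unfolding dec_def
    by (auto simp: dif_scale subset_eq scale_right_distrib intro: subspace_scale D(1) H(1))
  have dec_0: "c = 0" if "dec i 0 c h c'" for i c h c'
  proof -
    have cO: "c \<in> obj C (i - 1)" and m: "c \<in> D (i - 1)" "h \<in> H i" "c' \<in> D i" and eq: "dif C (i - 1) c + h + c' = 0"
      using that D(2) by (auto simp: dec_def)
    have bB: "dif C (i - 1) c \<in> ?B i" using cO by (auto simp: coboundaries_def)
    then have "dif C (i - 1) c + h \<in> ?Z i" using BZ H(3) m Z by (blast intro: subspace_add)
    moreover have "c' = - (dif C (i - 1) c + h)" using minus_unique[OF eq] by simp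
    ultimately have "c' \<in> ?Z i" using Z subspace_neg by metis
    then have "c' = 0" using m D(3) by blast
    then have "h = - dif C (i - 1) c" using eq minus_unique[of "dif C (i - 1) c" h] by simp
    then have "h \<in> ?B i" using bB B subspace_neg by metis
    then have "h = 0" using m H(4) by blast
    then have "dif C (i - 1) c = 0" using \<open>h = - dif C (i - 1) c\<close> by simp
    then have "c \<in> ?Z (i - 1)" using cO by (simp add: cocycles_def)
    then show ?thesis using m D(3) by blast
  qed
  have dec_unique: "c = d" if "dec i x c h c'" "dec i x d k d'" for i x c h c' d k d'
    using dec_0[OF dec_add[OF that(1) dec_scale[OF that(2), of "-1"], simplified]] by simp
  define \<sigma> where "\<sigma> i x = (SOME c. \<exists>h c'. dec i x c h c')" for i x
  have \<sigma>_eq: "\<sigma> i x = c" if "dec i x c h c'" for i x c h c'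
    unfolding \<sigma>_def by (rule some_equality) (use that dec_unique in blast)+
  define A where "A i = {b + c |b c. b \<in> ?B i \<and> c \<in> D i}" for i
  have "linear_map_on (obj C i) (scl C) (scl C) (\<sigma> i)" for i
    unfolding linear_map_on_def
  proof (intro conjI ballI allI)
    fix x y r assume x: "x \<in> obj C i"
    obtain c h c' where c: "dec i x c h c'" using dec_ex[OF x] by blast
    show "\<sigma> i (scl C r x) = scl C r (\<sigma> i x)" using \<sigma>_eq dec_scale c by metis
    assume "y \<in> obj C i"
    then obtain d k d' where d: "dec i y d k d'" using dec_ex by blast
    show "\<sigma> i (x + y) = \<sigma> i x + \<sigma> i y" using \<sigma>_eq dec_add c d by metis
  qed
  moreover have "\<sigma> i ` obj C i \<subseteq> obj C (i - 1)" for i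
    using dec_ex \<sigma>_eq D(2) unfolding dec_def by (smt (verit) image_subsetI subsetD)
  moreover have "A i \<subseteq> obj C i" for i
    unfolding A_def using BZ ZO D(2) obj subspace_add by blast
  moreover have "\<exists>h\<in>H i. \<exists>a\<in>A i. x = h + a" if x: "x \<in> obj C i" for i x
  proof -
    obtain c h c' where c: "dec i x c h c'" using dec_ex[OF x] by blast
    then have "dif C (i - 1) c \<in> ?B i" using D(2) by (auto simp: dec_def coboundaries_def)
    then have "dif C (i - 1) c + c' \<in> A i" using c by (auto simp: A_def dec_def)
    then show ?thesis using c by (intro bexI[of _ h] bexI) (auto simp: dec_def algebra_simps)
  qed
  moreover have "\<sigma> i h = 0" if "h \<in> H i" for i h
    by (rule \<sigma>_eq[of i h 0 h 0]) (use that D(1) in \<open>auto simp: dec_def dif_0 subspace_0\<close>)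
  moreover have "dif C (i - 1) (\<sigma> i a) + \<sigma> (i + 1) (dif C i a) = a" if a: "a \<in> A i" for i a
  proof -
    obtain b c' where bc: "b \<in> ?B i" "c' \<in> D i" "a = b + c'" using a by (auto simp: A_def)
    then have "b \<in> obj C i" using BZ ZO by blast
    then obtain c h c'' where c: "dec i b c h c''" using dec_ex by blast
    let ?dc = "dif C (i - 1) c"
    have cO: "c \<in> obj C (i - 1)" using c D(2) by (auto simp: dec_def)
    then have "?dc \<in> ?B i" by (auto simp: coboundaries_def)
    have "c'' \<in> D i" "h \<in> H i" "b - ?dc = h + c''" using c by (auto simp: dec_def)
    have *: "h + c'' \<in> ?B i" using \<open>b - ?dc = h + c''\<close> bc(1) \<open>?dc \<in> ?B i\<close> B subspace_diff by metis
    have "h \<in> ?Z i" using \<open>h \<in> H i\<close> H(3) by blast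
    then have "(h + c'') - h \<in> ?Z i" using * BZ Z subspace_diff by blast
    then have "c'' = 0" using \<open>c'' \<in> D i\<close> D(3) by auto
    then have "h = 0" using * \<open>h \<in> H i\<close> H(4) by auto
    have b: "b = ?dc" using \<open>b - ?dc = h + c''\<close> \<open>h = 0\<close> \<open>c'' = 0\<close> by simp
    have "\<sigma> i a = c"
      by (rule \<sigma>_eq[of i a c 0 c']) (use c bc b in \<open>auto simp: dec_def subspace_0 H(1)\<close>)
    have "dif C i b = 0" using bc(1) BZ by (auto simp: cocycles_def)
    then have "dif C i a = dif C i c'"
      using bc \<open>b \<in> obj C i\<close> D(2) by (auto simp: dif_add subset_eq)
    moreover have "\<sigma> (i + 1) (dif C i c') = c'"
      by (rule \<sigma>_eq[of "i + 1" _ c' 0 0]) (use bc D(1) H(1) in \<open>auto simp: dec_def subspace_0\<close>)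
    ultimately show ?thesis using \<open>\<sigma> i a = c\<close> b bc by simp
  qed
  ultimately have "contraction H A \<sigma>"
    using H(1,3,4) by (simp add: contraction_def)
  then show ?thesis using H(2) by blast
qed

end

section \<open>Maps on cohomology and truncations\<close>

lemma is_cpx_cochain_complex: "is_cpx C \<Longrightarrow> cochain_complex C"
  by unfold_locales

locale cochain_map = C: cochain_complex C + D: cochain_complex D
  for C :: "('k::field, 'v::ab_group_add) cpx" and D :: "('k, 'w::ab_group_add) cpx" +
  fixes f :: "int \<Rightarrow> 'v \<Rightarrow> 'w"
  assumes chain_map: "chain_map C D f"
begin

lemma map_obj: "x \<in> obj C i \<Longrightarrow> f i x \<in> obj D i"
  and map_dif: "x \<in> obj C i \<Longrightarrow> f (i + 1) (dif C i x) = dif D i (f i x)"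
  and map_linear: "linear_map_on (obj C i) (scl C) (scl D) (f i)"
  using chain_map by (auto simp: chain_map_def)

lemma map_0 [simp]: "f i 0 = 0"
  using C.linear_map_on_0 map_linear .

lemma map_add: "x \<in> obj C i \<Longrightarrow> y \<in> obj C i \<Longrightarrow> f i (x + y) = f i x + f i y"
  using map_linear by (simp add: linear_map_on_def)

lemma map_diff: "x \<in> obj C i \<Longrightarrow> y \<in> obj C i \<Longrightarrow> f i (x - y) = f i x - f i y"
  using map_add[of "x - y" i y] C.subspace_diff[OF C.subspace_obj] by simp

lemma map_cocycles: "x \<in> cocycles C i \<Longrightarrow> f i x \<in> cocycles D i"
  using map_obj map_dif[of x i] by (simp add: cocycles_def)

lemma map_coboundaries: "x \<in> coboundaries C i \<Longrightarrow> f i x \<in> coboundaries D i"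
  using map_obj map_dif[of _ "i - 1"] by (fastforce simp: coboundaries_def)

lemma coh_map_class:
  assumes x: "x \<in> cocycles C i"
  shows "coh_map D f i (coh_rel C i `` {x}) = coh_rel D i `` {f i x}"
proof -
  have eq: "coh_rel D i `` {f i x'} = coh_rel D i `` {f i x}" if "(x, x') \<in> coh_rel C i" for x'
  proof -
    have x': "x' \<in> cocycles C i" "x - x' \<in> coboundaries C i" using that by (auto simp: coh_rel_def)
    then have "f i x - f i x' \<in> coboundaries D i"
      using map_coboundaries map_diff x by (metis C.cocycles_obj subsetD)
    then show ?thesis
      using D.coh_class_eq_iff map_cocycles x x'(1) by metis
  qed
  have "(x, x) \<in> coh_rel C i" using x equiv_class_self[OF C.equiv_coh_rel] by blast
  have "coh_map D f i (coh_rel C i `` {x}) = (\<Union>x'\<in>coh_rel C i `` {x}. coh_rel D i `` {f i x'})"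
    by (auto simp: coh_map_def)
  also have "\<dots> = (\<Union>x'\<in>coh_rel C i `` {x}. coh_rel D i `` {f i x})"
    by (rule SUP_cong) (use eq in auto)
  also have "\<dots> = coh_rel D i `` {f i x}" using \<open>(x, x) \<in> coh_rel C i\<close> by auto
  finally show ?thesis .
qed

lemma inj_on_coh_map_iff:
  "inj_on (coh_map D f i) (coh C i) \<longleftrightarrow> (\<forall>x\<in>cocycles C i. f i x \<in> coboundaries D i \<longrightarrow> x \<in> coboundaries C i)"
    (is "_ \<longleftrightarrow> ?R")
proof
  assume inj: "inj_on (coh_map D f i) (coh C i)"
  show ?R
  proof (intro ballI impI)
    fix x assume x: "x \<in> cocycles C i" "f i x \<in> coboundaries D i"
    have 0: "0 \<in> cocycles C i" by (rule C.subspace_0[OF C.subspace_cocycles])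
    have "coh_map D f i (coh_rel C i `` {x}) = coh_map D f i (coh_rel C i `` {0})"
      using x 0 map_cocycles[of x i] D.coh_class_eq_0_iff by (simp add: coh_map_class D.coh_zero_class)
    then have "coh_rel C i `` {x} = coh_rel C i `` {0}"
      using inj x 0 by (auto simp: C.coh_eq inj_on_def)
    then show "x \<in> coboundaries C i" using x C.coh_class_eq_0_iff C.coh_zero_class by simp
  qed
next
  assume R: ?R
  show "inj_on (coh_map D f i) (coh C i)"
  proof (rule inj_onI)
    fix a b assume "a \<in> coh C i" "b \<in> coh C i" and eq: "coh_map D f i a = coh_map D f i b"
    then obtain x y where x: "x \<in> cocycles C i" "a = coh_rel C i `` {x}"
      and y: "y \<in> cocycles C i" "b = coh_rel C i `` {y}" by (auto simp: C.coh_eq)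
    have "f i x - f i y \<in> coboundaries D i"
      using eq x y D.coh_class_eq_iff[OF map_cocycles map_cocycles] by (simp add: coh_map_class)
    then have "f i (x - y) \<in> coboundaries D i"
      using map_diff x y C.cocycles_obj by (metis subsetD)
    then have "x - y \<in> coboundaries C i"
      using R x y C.subspace_diff[OF C.subspace_cocycles] by blast
    then show "a = b" using x y C.coh_class_eq_iff by simp
  qed
qed

lemma coh_map_surj_iff:
  "coh_map D f i ` coh C i = coh D i \<longleftrightarrow> (\<forall>z\<in>cocycles D i. \<exists>x\<in>cocycles C i. z - f i x \<in> coboundaries D i)"
proof -
  have img: "coh_map D f i ` coh C i = (\<lambda>x. coh_rel D i `` {f i x}) ` cocycles C i"
    unfolding C.coh_eq image_image by (rule image_cong) (simp_all add: coh_map_class)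
  have "coh_map D f i ` coh C i \<subseteq> coh D i" unfolding img using map_cocycles by (auto simp: D.coh_eq)
  then have "coh_map D f i ` coh C i = coh D i \<longleftrightarrow> coh D i \<subseteq> coh_map D f i ` coh C i"
    by auto
  also have "\<dots> \<longleftrightarrow>
      (\<forall>z\<in>cocycles D i. \<exists>x\<in>cocycles C i. coh_rel D i `` {z} = coh_rel D i `` {f i x})"
    by (simp only: img D.coh_eq image_subset_iff image_iff)
  also have "\<dots> \<longleftrightarrow> (\<forall>z\<in>cocycles D i. \<exists>x\<in>cocycles C i. z - f i x \<in> coboundaries D i)"
    by (intro ball_cong bex_cong refl D.coh_class_eq_iff map_cocycles)
  finally show ?thesis .
qed

end

lemma (in cochain_complex) trunc_le_parts:
  "i \<le> c \<Longrightarrow> cocycles (trunc_le c C) i = cocycles C i"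
  "i \<le> c \<Longrightarrow> coboundaries (trunc_le c C) i = coboundaries C i"
  "c < i \<Longrightarrow> cocycles (trunc_le c C) i = {0}"
  by (auto simp: cocycles_def coboundaries_def trunc_le_def)

lemma (in cochain_complex) is_cpx_trunc_le: "is_cpx (trunc_le c C)"
  unfolding is_cpx_def
proof (intro conjI allI ballI)
  show "vector_space (scl (trunc_le c C))"
    using vector_space_axioms by (simp add: trunc_le_def)
  fix i
  show "module.subspace (scl (trunc_le c C)) (obj (trunc_le c C) i)"
    using subspace_obj subspace_cocycles by (simp add: trunc_le_def)
  have obj: "obj (trunc_le c C) i \<subseteq> obj C i" using cocycles_obj by (auto simp: trunc_le_def)
  have "linear_map_on (obj C i) (scl C) (scl C) (dif C i)"
    using cpx by (simp add: is_cpx_def)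
  from linear_map_on_subset[OF this obj]
  show "linear_map_on (obj (trunc_le c C) i) (scl (trunc_le c C)) (scl (trunc_le c C)) (dif (trunc_le c C) i)"
    by (simp add: trunc_le_def)
  show "dif (trunc_le c C) i ` obj (trunc_le c C) i \<subseteq> obj (trunc_le c C) (i + 1)"
    using dif_obj dif_dif by (auto simp: trunc_le_def cocycles_def)
  show "dif (trunc_le c C) (i + 1) (dif (trunc_le c C) i x) = 0" if "x \<in> obj (trunc_le c C) i" for x
    using dif_dif obj that by (auto simp: trunc_le_def)
qed

text \<open>
  Truncation leaves cohomology in degrees at most \<open>c\<close> unchanged and kills it above \<open>c\<close>.
\<close>

lemma (in cochain_map) quasi_iso_trunc_le:
  assumes inj: "\<And>i x. i \<le> c \<Longrightarrow> x \<in> cocycles C i \<Longrightarrow> f i x \<in> coboundaries D i \<Longrightarrow> x \<in> coboundaries C i"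
    and surj: "\<And>i z. i \<le> c \<Longrightarrow> z \<in> cocycles D i \<Longrightarrow> \<exists>x\<in>cocycles C i. z - f i x \<in> coboundaries D i"
  shows "quasi_iso (trunc_le c C) (trunc_le c D) f"
proof -
  have chain: "chain_map (trunc_le c C) (trunc_le c D) f"
    unfolding chain_map_def
  proof (intro allI conjI ballI)
    fix i
    have obj: "obj (trunc_le c C) i \<subseteq> obj C i" using C.cocycles_obj by (auto simp: trunc_le_def)
    from linear_map_on_subset[OF map_linear this]
    show "linear_map_on (obj (trunc_le c C) i) (scl (trunc_le c C)) (scl (trunc_le c D)) (f i)"
      by (simp add: trunc_le_def)
    show "f i ` obj (trunc_le c C) i \<subseteq> obj (trunc_le c D) i"
      using map_obj map_cocycles by (auto simp: trunc_le_def)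
    show "f (i + 1) (dif (trunc_le c C) i x) = dif (trunc_le c D) i (f i x)" if "x \<in> obj (trunc_le c C) i" for x
      using map_dif obj that by (auto simp: trunc_le_def)
  qed
  interpret T: cochain_map "trunc_le c C" "trunc_le c D" f
    by unfold_locales (rule C.is_cpx_trunc_le D.is_cpx_trunc_le chain)+
  have "bij_betw (coh_map (trunc_le c D) f i) (coh (trunc_le c C) i) (coh (trunc_le c D) i)" for i
    unfolding bij_betw_def T.inj_on_coh_map_iff T.coh_map_surj_iff
  proof (cases "i \<le> c")
    case True
    then show "(\<forall>x\<in>cocycles (trunc_le c C) i. f i x \<in> coboundaries (trunc_le c D) i \<longrightarrow> x \<in> coboundaries (trunc_le c C) i) \<and>
      (\<forall>z\<in>cocycles (trunc_le c D) i. \<exists>x\<in>cocycles (trunc_le c C) i. z - f i x \<in> coboundaries (trunc_le c D) i)"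
      using inj surj by (simp add: C.trunc_le_parts D.trunc_le_parts)
  next
    case False
    then show "(\<forall>x\<in>cocycles (trunc_le c C) i. f i x \<in> coboundaries (trunc_le c D) i \<longrightarrow> x \<in> coboundaries (trunc_le c C) i) \<and>
      (\<forall>z\<in>cocycles (trunc_le c D) i. \<exists>x\<in>cocycles (trunc_le c C) i. z - f i x \<in> coboundaries (trunc_le c D) i)"
      using T.C.subspace_0[OF T.C.subspace_coboundaries] T.D.subspace_0[OF T.D.subspace_coboundaries]
      by (simp add: C.trunc_le_parts D.trunc_le_parts)
  qed
  then show ?thesis using chain by (simp add: quasi_iso_def)
qed

section \<open>Symmetric algebras and their derivations\<close>

lemma lookup_pm_scale [simp]:
  "Poly_Mapping.lookup (pm_scale c f) x = c * Poly_Mapping.lookup f x"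
  unfolding pm_scale_def by (simp add: Poly_Mapping.map.rep_eq when_def)

lemma vector_space_pm_scale: "vector_space (pm_scale :: 'k::field \<Rightarrow> ('x \<Rightarrow>\<^sub>0 'k) \<Rightarrow> _)"
  by unfold_locales (auto intro!: poly_mapping_eqI simp: lookup_add algebra_simps)

lemma koszul_sign_even: "even n \<Longrightarrow> koszul_sign n = 1"
  and koszul_sign_odd: "odd n \<Longrightarrow> koszul_sign n = -1"
  by (auto simp: koszul_sign_def)

lemma letters_iff: "(d, i, v) \<in> letters X \<longleftrightarrow> d \<noteq> 0 \<and> v \<in> obj (X d) i"
  by (auto simp: letters_def)

lemma words_Nil [simp]: "[] \<in> words X"
  and words_Cons [simp]: "l # w \<in> words X \<longleftrightarrow> l \<in> letters X \<and> w \<in> words X"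
  and words_append [simp]: "v @ w \<in> words X \<longleftrightarrow> v \<in> words X \<and> w \<in> words X"
  by (auto simp: words_def)

lemma word_prod_Nil [simp]: "word_prod \<iota> [] = 1"
  and word_prod_Cons [simp]: "word_prod \<iota> ((d, i, v) # w) = \<iota> d i v * word_prod \<iota> w"
  and word_prod_append [simp]: "word_prod \<iota> (w @ w') = word_prod \<iota> w * word_prod \<iota> w'"
  by (auto simp: word_prod_def)

lemma word_mdeg_Nil [simp]: "word_mdeg [] = 0"
  and word_mdeg_Cons [simp]: "word_mdeg ((d, i, v) # w) = d + word_mdeg w"
  and word_mdeg_append [simp]: "word_mdeg (w @ w') = word_mdeg w + word_mdeg w'"
  by (auto simp: word_mdeg_def)

lemma word_cdeg_Nil [simp]: "word_cdeg [] = 0"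
  and word_cdeg_Cons [simp]: "word_cdeg ((d, i, v) # w) = i + 1 + word_cdeg w"
  and word_cdeg_append [simp]: "word_cdeg (w @ w') = word_cdeg w + word_cdeg w'"
  by (auto simp: word_cdeg_def)

text \<open>
  The value on a word of the derivation that takes the letter \<open>(d, i, v)\<close> to \<open>g d i v\<close>; only the
  parity of its degree \<open>r\<close> matters.
\<close>

fun word_deriv ::
  "('m mdeg \<Rightarrow> int \<Rightarrow> 'v \<Rightarrow> 'a::ring_1) \<Rightarrow> int \<Rightarrow> ('m mdeg \<Rightarrow> int \<Rightarrow> 'v \<Rightarrow> 'a)
    \<Rightarrow> ('m, 'v) letter list \<Rightarrow> 'a" where
  "word_deriv \<iota> r g [] = 0"
| "word_deriv \<iota> r g ((d, i, v) # w) =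
     g d i v * word_prod \<iota> w + koszul_sign (r * (i + 1)) * (\<iota> d i v * word_deriv \<iota> r g w)"

lemma koszul_sign_mult_left: "koszul_sign (r * (m + n)) = (koszul_sign (r * m) * koszul_sign (r * n) :: 'a::ring_1)"
  by (auto simp: koszul_sign_def)

lemma koszul_sign_commutes: "koszul_sign n * x = x * (koszul_sign n :: 'a::ring_1)"
  by (auto simp: koszul_sign_def)

lemma word_deriv_append:
  "word_deriv \<iota> r g (w @ w') =
     word_deriv \<iota> r g w * word_prod \<iota> w' + koszul_sign (r * word_cdeg w) * (word_prod \<iota> w * word_deriv \<iota> r g w')"
proof (induction w)
  case Nil
  then show ?case by (simp add: koszul_sign_def)
next
  case (Cons l w)
  obtain d i v where l: "l = (d, i, v)" by (cases l)
  have "koszul_sign (r * (i + 1)) * (\<iota> d i v * (koszul_sign (r * word_cdeg w) * z)) =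
      koszul_sign (r * (i + 1 + word_cdeg w)) * (\<iota> d i v * z)" for z
    unfolding koszul_sign_mult_left[of r "i+1"]
    by (metis koszul_sign_commutes mult.assoc)
  then show ?case
    by (simp add: l Cons distrib_left distrib_right mult.assoc)
qed

text \<open>
  Graded commutativity of two adjacent letters passes through a surrounding word, so that it need be
  checked only on words of length two.
\<close>

lemma word_deriv_context:
  assumes "word_prod \<iota> m = koszul_sign n * word_prod \<iota> m'"
    "word_deriv \<iota> r g m = koszul_sign n * word_deriv \<iota> r g m'"
    "word_cdeg m = word_cdeg m'"
  shows "word_deriv \<iota> r g (xs @ m @ ys) = koszul_sign n * word_deriv \<iota> r g (xs @ m' @ ys)"
  using assms
  by (cases "even n") (simp_all add: word_deriv_append koszul_sign_even koszul_sign_odd algebra_simps)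

locale symmetric_algebra =
  fixes X :: "('k::field, 'm, 'v::ab_group_add) gcpx"
    and s :: "'k \<Rightarrow> 'a::ring_1 \<Rightarrow> 'a"
    and \<iota> :: "'m mdeg \<Rightarrow> int \<Rightarrow> 'v \<Rightarrow> 'a"
  assumes cpx: "d \<noteq> 0 \<Longrightarrow> is_cpx (X d)"
    and sym: "is_symmetric_algebra X s \<iota>"
begin

sublocale vector_space s
  using sym by (simp add: is_symmetric_algebra_def)

sublocale FW: vector_space "pm_scale :: 'k \<Rightarrow> (('m, 'v) letter list \<Rightarrow>\<^sub>0 'k) \<Rightarrow> _"
  by (rule vector_space_pm_scale)

sublocale E: vector_space_pair s s ..

abbreviation linear_op :: "('a \<Rightarrow> 'a) \<Rightarrow> bool" where
  "linear_op \<equiv> Vector_Spaces.linear s s"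

abbreviation pr :: "('m, 'v) letter list \<Rightarrow> 'a" where
  "pr \<equiv> word_prod \<iota>"

lemma scale_mult: "s c (x * y) = s c x * y" and mult_scale: "x * s c y = s c (x * y)"
  using sym unfolding is_symmetric_algebra_def by metis+

lemma span_words: "span (pr ` words X) = UNIV"
  using sym by (simp add: is_symmetric_algebra_def)

definition lin_ext :: "(('m, 'v) letter list \<Rightarrow> 'a) \<Rightarrow> (('m, 'v) letter list \<Rightarrow>\<^sub>0 'k) \<Rightarrow> 'a" where
  "lin_ext \<Theta> f = (\<Sum>w\<in>Poly_Mapping.keys f. s (Poly_Mapping.lookup f w) (\<Theta> w))"

lemma lin_ext_superset:
  assumes "finite S" "Poly_Mapping.keys f \<subseteq> S"
  shows "lin_ext \<Theta> f = (\<Sum>w\<in>S. s (Poly_Mapping.lookup f w) (\<Theta> w))"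
  unfolding lin_ext_def
  by (rule sum.mono_neutral_left) (use assms in \<open>auto simp: in_keys_iff\<close>)

lemma lin_ext_add: "lin_ext \<Theta> (f + g) = lin_ext \<Theta> f + lin_ext \<Theta> g"
proof -
  let ?S = "Poly_Mapping.keys f \<union> Poly_Mapping.keys g"
  have "lin_ext \<Theta> h = (\<Sum>w\<in>?S. s (Poly_Mapping.lookup h w) (\<Theta> w))" if "h \<in> {f, g, f + g}" for h
    by (rule lin_ext_superset) (use that Poly_Mapping.keys_add[of f g] in auto)
  then show ?thesis
    by (simp add: lookup_add scale_left_distrib sum.distrib)
qed

lemma lin_ext_scale: "lin_ext \<Theta> (pm_scale c f) = s c (lin_ext \<Theta> f)"
proof -
  have "lin_ext \<Theta> (pm_scale c f) = (\<Sum>w\<in>Poly_Mapping.keys f. s (Poly_Mapping.lookup (pm_scale c f) w) (\<Theta> w))"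
    by (rule lin_ext_superset) (auto simp: in_keys_iff)
  then show ?thesis
    by (simp add: lin_ext_def scale_sum_right)
qed

lemma lin_ext_linear: "Vector_Spaces.linear pm_scale s (lin_ext \<Theta>)"
  by unfold_locales (simp_all add: lin_ext_add lin_ext_scale)

lemma lin_ext_diff: "lin_ext \<Theta> (f - g) = lin_ext \<Theta> f - lin_ext \<Theta> g"
  by (metis add_diff_cancel diff_add_cancel lin_ext_add)

lemma lin_ext_single [simp]: "lin_ext \<Theta> (Poly_Mapping.single w c) = s c (\<Theta> w)"
  by (cases "c = 0") (simp_all add: lin_ext_def)

lemma lin_ext_pr_eq_0_iff:
  assumes "Poly_Mapping.keys f \<subseteq> words X"
  shows "lin_ext pr f = 0 \<longleftrightarrow> f \<in> FW.span (sym_rels X)"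
  using sym assms unfolding is_symmetric_algebra_def lin_ext_def by blast

lemma letters_scale: "(d, i, u) \<in> letters X \<Longrightarrow> (d, i, scl (X d) c u) \<in> letters X"
  and letters_add: "(d, i, u) \<in> letters X \<Longrightarrow> (d, i, v) \<in> letters X \<Longrightarrow> (d, i, u + v) \<in> letters X"
proof -
  assume u: "(d, i, u) \<in> letters X"
  then have "is_cpx (X d)" using cpx by (auto simp: letters_iff)
  then interpret Xd: vector_space "scl (X d)" by (simp add: is_cpx_def)
  have "Xd.subspace (obj (X d) i)" using \<open>is_cpx (X d)\<close> by (simp add: is_cpx_def)
  then show "(d, i, scl (X d) c u) \<in> letters X" 
    "(d, i, v) \<in> letters X \<Longrightarrow> (d, i, u + v) \<in> letters X"
    using u by (auto simp: letters_iff Xd.subspace_add Xd.subspace_scale)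
qed

lemma keys_sym_rels: "f \<in> sym_rels X \<Longrightarrow> Poly_Mapping.keys f \<subseteq> words X"
proof (induction rule: sym_rels.induct)
  case (add xs ys d i u v)
  then show ?case
    by (intro order_trans[OF keys_diff] Un_least) (auto split: if_splits simp: letters_add)
next
  case (scale xs ys d i v c)
  then show ?case
    by (intro order_trans[OF keys_diff] Un_least) (auto split: if_splits simp: letters_scale)
next
  case (comm xs ys d i u e j v)
  then show ?case
    by (intro order_trans[OF keys_diff] Un_least) (auto split: if_splits)
qed

lemma lin_ext_pr_rels: "f \<in> sym_rels X \<Longrightarrow> lin_ext pr f = 0"
  using lin_ext_pr_eq_0_iff[OF keys_sym_rels] FW.span_base by blast

lemma incl_add:
  assumes "(d, i, u) \<in> letters X" "(d, i, v) \<in> letters X"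
  shows "\<iota> d i (u + v) = \<iota> d i u + \<iota> d i v"
  using lin_ext_pr_rels[OF sym_rels.add[OF words_Nil words_Nil assms]]
  by (simp add: lin_ext_diff diff_eq_eq add.commute)

lemma incl_scale:
  assumes "(d, i, v) \<in> letters X"
  shows "\<iota> d i (scl (X d) c v) = s c (\<iota> d i v)"
  using lin_ext_pr_rels[OF sym_rels.scale[OF words_Nil words_Nil assms]]
  by (simp add: lin_ext_diff)

lemma scale_koszul_sign: "s (koszul_sign n) x = koszul_sign n * x"
  by (simp add: koszul_sign_def)

lemma incl_commute:
  assumes "(d, i, u) \<in> letters X" "(e, j, v) \<in> letters X"
  shows "\<iota> d i u * \<iota> e j v = koszul_sign ((i + 1) * (j + 1)) * (\<iota> e j v * \<iota> d i u)"
  using lin_ext_pr_rels[OF sym_rels.comm[OF words_Nil words_Nil assms]]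
  by (simp add: lin_ext_diff scale_koszul_sign)

lemma lin_ext_surj: "\<exists>f. Poly_Mapping.keys f \<subseteq> words X \<and> lin_ext pr f = x"
proof -
  have "x \<in> span (pr ` words X)" using span_words by simp
  then show ?thesis
  proof (induction rule: span_induct_alt)
    case base
    then show ?case by (intro exI[of _ 0]) (simp add: lin_ext_def)
  next
    case (step c y z)
    then obtain f w where f: "Poly_Mapping.keys f \<subseteq> words X" "lin_ext pr f = z"
      and w: "w \<in> words X" "y = pr w" by blast
    show ?case
      by (rule exI[of _ "Poly_Mapping.single w c + f"])
        (use f w Poly_Mapping.keys_add[of "Poly_Mapping.single w c" f] in
          \<open>auto simp: lin_ext_add split: if_splits\<close>)
  qed
qed

text \<open>
  The evaluation of words is onto, with kernel the span of the relations; hence a linear operator may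
  be prescribed on words if the prescription respects the relations.
\<close>

lemma linear_op_on_words_exists:
  assumes rels: "\<And>f. f \<in> sym_rels X \<Longrightarrow> lin_ext \<Theta> f = 0"
  shows "\<exists>\<theta>. linear_op \<theta> \<and> (\<forall>w\<in>words X. \<theta> (pr w) = \<Theta> w)"
proof -
  define repr where "repr x = (SOME f. Poly_Mapping.keys f \<subseteq> words X \<and> lin_ext pr f = x)" for x
  have repr: "Poly_Mapping.keys (repr x) \<subseteq> words X" "lin_ext pr (repr x) = x" for x
    using someI_ex[OF lin_ext_surj[of x]] unfolding repr_def by blast+
  interpret L: Vector_Spaces.linear pm_scale s "lin_ext \<Theta>" by (rule lin_ext_linear)
  have eq: "lin_ext \<Theta> (repr x) = lin_ext \<Theta> f" 
    if f: "Poly_Mapping.keys f \<subseteq> words X" "lin_ext pr f = x" for f x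
  proof -
    have "Poly_Mapping.keys (repr x - f) \<subseteq> words X"
      using keys_diff[of "repr x" f] repr f by blast
    moreover have "lin_ext pr (repr x - f) = 0"
      using repr f by (simp add: lin_ext_diff)
    ultimately have "repr x - f \<in> FW.span (sym_rels X)"
      by (simp add: lin_ext_pr_eq_0_iff)
    then have "lin_ext \<Theta> (repr x - f) = 0"
      by (rule L.eq_0_on_span[rotated]) (rule rels)
    then show ?thesis by (simp add: lin_ext_diff)
  qed
  show ?thesis
  proof (intro exI conjI ballI)
    show "linear_op (\<lambda>x. lin_ext \<Theta> (repr x))"
    proof unfold_locales
      fix x y c
      have "lin_ext \<Theta> (repr (x + y)) = lin_ext \<Theta> (repr x + repr y)"
        by (rule eq) (use keys_add[of "repr x" "repr y"] repr in \<open>auto simp: lin_ext_add\<close>)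
      then show "lin_ext \<Theta> (repr (x + y)) = lin_ext \<Theta> (repr x) + lin_ext \<Theta> (repr y)"
        by (simp add: lin_ext_add)
      have "lin_ext \<Theta> (repr (s c x)) = lin_ext \<Theta> (pm_scale c (repr x))"
        by (rule eq) (use repr in \<open>auto simp: lin_ext_scale in_keys_iff subset_eq\<close>)
      then show "lin_ext \<Theta> (repr (s c x)) = s c (lin_ext \<Theta> (repr x))"
        by (simp add: lin_ext_scale)
    qed
    show "lin_ext \<Theta> (repr (pr w)) = \<Theta> w" if "w \<in> words X" for w
      using eq[of "Poly_Mapping.single w 1" "pr w"] that by simp
  qed
qed

text \<open>
  A derivation is determined by arbitrary linear values on the letters, provided that these values
  commute with the letters up to the sign of their degrees: this is what the commutativity relations
  require.
\<close>

lemma derivation_exists: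
  assumes g_add: "\<And>d i u v. (d, i, u) \<in> letters X \<Longrightarrow> (d, i, v) \<in> letters X \<Longrightarrow> g d i (u + v) = g d i u + g d i v"
    and g_scale: "\<And>d i v c. (d, i, v) \<in> letters X \<Longrightarrow> g d i (scl (X d) c v) = s c (g d i v)"
    and g_commute: "\<And>d i u e j v. (d, i, u) \<in> letters X \<Longrightarrow> (e, j, v) \<in> letters X \<Longrightarrow>
      g d i u * \<iota> e j v = koszul_sign ((i + 1 + r) * (j + 1)) * (\<iota> e j v * g d i u)"
  shows "\<exists>\<theta>. linear_op \<theta> \<and> (\<forall>w\<in>words X. \<theta> (pr w) = word_deriv \<iota> r g w)"
proof (rule linear_op_on_words_exists)
  fix f
  assume "f \<in> sym_rels X"
  then show "lin_ext (word_deriv \<iota> r g) f = 0"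
  proof cases
    case (add xs ys d i u v)
    then show ?thesis
      unfolding add(1) lin_ext_diff lin_ext_single
      by (simp add: word_deriv_append g_add incl_add algebra_simps)
  next
    case (scale xs ys d i v c)
    then show ?thesis
      unfolding scale(1) lin_ext_diff lin_ext_single
      by (simp add: word_deriv_append g_scale incl_scale algebra_simps scale_mult[symmetric] mult_scale scale_right_distrib)
  next
    case (comm xs ys d i u e j v)
    let ?uv = "[(d, i, u), (e, j, v)]" and ?vu = "[(e, j, v), (d, i, u)]"
    let ?\<epsilon> = "koszul_sign ((i + 1) * (j + 1)) :: 'a"
    have "pr ?uv = ?\<epsilon> * pr ?vu"
      using incl_commute[OF comm(4,5)] by simp
    moreover have "word_deriv \<iota> r g ?uv = ?\<epsilon> * word_deriv \<iota> r g ?vu"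
      using g_commute[OF comm(4,5)] g_commute[OF comm(5,4)]
      by (cases "even i"; cases "even j"; cases "even r")
        (simp_all add: koszul_sign_even koszul_sign_odd algebra_simps)
    moreover have "word_cdeg ?uv = word_cdeg ?vu"
      by simp
    ultimately have "word_deriv \<iota> r g (xs @ ?uv @ ys) = ?\<epsilon> * word_deriv \<iota> r g (xs @ ?vu @ ys)"
      by (rule word_deriv_context)
    then show ?thesis
      unfolding comm(1) lin_ext_diff lin_ext_single scale_koszul_sign by simp
  qed
qed

text \<open>
  All subspaces of the algebra that occur below are spanned by words subject to a condition; products
  and linear maps are then compared on words.
\<close>

definition word_span :: "(('m, 'v) letter list \<Rightarrow> bool) \<Rightarrow> 'a set" where
  "word_span P = span (pr ` {w \<in> words X. P w})"

lemma subspace_word_span: "subspace (word_span P)"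
  by (simp add: word_span_def)

lemma word_span_base: "w \<in> words X \<Longrightarrow> P w \<Longrightarrow> pr w \<in> word_span P"
  by (auto simp: word_span_def intro: span_base)

lemma word_span_UNIV: "x \<in> word_span (\<lambda>w. True)"
  using span_words by (simp add: word_span_def)

lemma word_span_least:
  assumes "subspace S" "\<And>w. w \<in> words X \<Longrightarrow> P w \<Longrightarrow> pr w \<in> S"
  shows "word_span P \<subseteq> S"
  unfolding word_span_def by (rule span_minimal) (use assms in auto)

lemma word_span_mono:
  "(\<And>w. w \<in> words X \<Longrightarrow> P w \<Longrightarrow> Q w) \<Longrightarrow> word_span P \<subseteq> word_span Q"
  by (intro word_span_least subspace_word_span word_span_base)

lemma linear_op_word_span:
  assumes "linear_op \<theta>" "\<And>w. w \<in> words X \<Longrightarrow> P w \<Longrightarrow> \<theta> (pr w) \<in> S" "subspace S" "x \<in> word_span P"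
  shows "\<theta> x \<in> S"
proof -
  have "word_span P \<subseteq> {x. \<theta> x \<in> S}"
    by (rule word_span_least) (use assms E.linear_subspace_linear_preimage in auto)
  then show ?thesis using assms by auto
qed

lemma linear_op_mult_left: "linear_op ((*) x)"
  by unfold_locales (simp_all add: distrib_left mult_scale)

lemma linear_op_mult_right: "linear_op (\<lambda>y. y * x)"
  by unfold_locales (simp_all add: distrib_right scale_mult)

lemma word_span_mult:
  assumes "\<And>w w'. P w \<Longrightarrow> Q w' \<Longrightarrow> R (w @ w')" "x \<in> word_span P" "y \<in> word_span Q"
  shows "x * y \<in> word_span R"
proof (rule linear_op_word_span[OF linear_op_mult_right _ subspace_word_span assms(2)])
  fix w assume w: "w \<in> words X" "P w"
  show "pr w * y \<in> word_span R"
  proof (rule linear_op_word_span[OF linear_op_mult_left _ subspace_word_span assms(3)])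
    fix w' assume "w' \<in> words X" "Q w'"
    then have "pr (w @ w') \<in> word_span R"
      using w assms(1) by (intro word_span_base) auto
    then show "pr w * pr w' \<in> word_span R" by simp
  qed
qed

lemma linear_op_eq_on_word_span:
  assumes "linear_op f" "linear_op g" "\<And>w. w \<in> words X \<Longrightarrow> P w \<Longrightarrow> f (pr w) = g (pr w)"
    "x \<in> word_span P"
  shows "f x = g x"
  by (rule E.linear_eq_on_span[where B = "pr ` {w \<in> words X. P w}"])
    (use assms in \<open>auto simp: word_span_def\<close>)

lemma word_deriv_leibniz:
  assumes \<theta>: "linear_op \<theta>" "\<forall>w\<in>words X. \<theta> (pr w) = word_deriv \<iota> r g w"
    and x: "x \<in> word_span (\<lambda>w. word_cdeg w = n)"
  shows "\<theta> (x * y) = \<theta> x * y + koszul_sign (r * n) * (x * \<theta> y)"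
proof -
  interpret \<theta>: Vector_Spaces.linear s s \<theta> by (rule \<theta>)
  have eq: "\<theta> (pr w * y) = \<theta> (pr w) * y + koszul_sign (r * word_cdeg w) * (pr w * \<theta> y)"
    if w: "w \<in> words X" for w
  proof (rule linear_op_eq_on_word_span[where x = y and P = "\<lambda>w. True"])
    show "linear_op (\<lambda>y. \<theta> (pr w * y))"
      by unfold_locales (simp_all add: distrib_left mult_scale \<theta>.add \<theta>.scale)
    show "linear_op (\<lambda>y. \<theta> (pr w) * y + koszul_sign (r * word_cdeg w) * (pr w * \<theta> y))"
      by unfold_locales
        (simp_all add: distrib_left mult_scale \<theta>.add \<theta>.scale scale_right_distrib)
    show "\<theta> (pr w * pr w') = \<theta> (pr w) * pr w' + koszul_sign (r * word_cdeg w) * (pr w * \<theta> (pr w'))"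
      if "w' \<in> words X" for w'
    proof -
      have "\<theta> (pr (w @ w')) = word_deriv \<iota> r g (w @ w')"
        using w that \<theta>(2) by (simp del: word_prod_append)
      then show ?thesis
        using w that \<theta>(2) by (simp add: word_deriv_append)
    qed
  qed (rule word_span_UNIV)
  show ?thesis
  proof (rule linear_op_eq_on_word_span[OF _ _ _ x])
    show "linear_op (\<lambda>x. \<theta> (x * y))"
      by unfold_locales (simp_all add: distrib_right scale_mult[symmetric] \<theta>.add \<theta>.scale)
    show "linear_op (\<lambda>x. \<theta> x * y + koszul_sign (r * n) * (x * \<theta> y))"
      by unfold_locales
        (simp_all add: distrib_left distrib_right scale_mult[symmetric] mult_scale \<theta>.add \<theta>.scale scale_right_distrib)
    show "\<theta> (pr w * y) = \<theta> (pr w) * y + koszul_sign (r * n) * (pr w * \<theta> y)"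
      if "w \<in> words X" "word_cdeg w = n" for w
      using eq that by auto
  qed
qed

lemma word_span_letter:
  assumes "(d, i, v) \<in> letters X" "P [(d, i, v)]"
  shows "\<iota> d i v \<in> word_span P"
  using word_span_base[of "[(d, i, v)]" P] assms by simp

text \<open>
  Here \<open>R w u\<close> says that the word \<open>u\<close> may occur in the derivative of the word \<open>w\<close>; this bounds degrees
  and lengths of derivatives once they are known on letters.
\<close>

lemma word_deriv_in_word_span:
  assumes g: "\<And>d i v. (d, i, v) \<in> letters X \<Longrightarrow> g d i v \<in> word_span (Q (d, i, v))"
    and head: "\<And>l u w. Q l u \<Longrightarrow> R (l # w) (u @ w)"
    and tail: "\<And>l w w'. R w w' \<Longrightarrow> R (l # w) (l # w')"
  shows "w \<in> words X \<Longrightarrow> word_deriv \<iota> r g w \<in> word_span (R w)"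
proof (induction w)
  case Nil
  then show ?case
    by (simp add: subspace_word_span subspace_0)
next
  case (Cons l w)
  obtain d i v where l: "l = (d, i, v)" by (cases l)
  have "g d i v * pr w \<in> word_span (R (l # w))"
    by (rule word_span_mult[where P = "Q l" and Q = "\<lambda>w'. w' = w"])
      (use Cons l g head in \<open>auto intro: word_span_base\<close>)
  moreover have "\<iota> d i v * word_deriv \<iota> r g w \<in> word_span (R (l # w))"
    by (rule word_span_mult[where P = "\<lambda>w. w = [l]" and Q = "R w"])
      (use Cons l tail in \<open>auto intro: word_span_letter\<close>)
  ultimately show ?case
    by (simp add: l subspace_add subspace_scale subspace_word_span flip: scale_koszul_sign)
qed

text \<open>
  The letter \<open>(d, -1, v)\<close> has degree \<open>0\<close> in \<open>X[-1]\<close>, so no sign arises when it moves past another letter.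
\<close>

lemma letter_degree_0_central:
  assumes "(d, -1, v) \<in> letters X"
  shows "\<iota> d (-1) v * x = x * \<iota> d (-1) v"
proof (rule linear_op_eq_on_word_span[OF linear_op_mult_left linear_op_mult_right _ word_span_UNIV])
  show "\<iota> d (-1) v * pr w = pr w * \<iota> d (-1) v" if "w \<in> words X" for w
    using that
  proof (induction w)
    case (Cons l w)
    obtain e j u where l: "l = (e, j, u)" by (cases l)
    have "\<iota> d (-1) v * \<iota> e j u = \<iota> e j u * \<iota> d (-1) v"
      using incl_commute[OF assms, of e j u] Cons.prems by (simp add: l koszul_sign_def)
    then show ?case
      using Cons by (simp add: l mult.assoc[symmetric]) (simp add: mult.assoc)
  qed simp
qed

end

locale symmetric_algebra_char_0 = symmetric_algebra X s \<iota>
  for X :: "('k::field_char_0, 'm, 'v::ab_group_add) gcpx"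
    and s :: "'k \<Rightarrow> 'a::ring_1 \<Rightarrow> 'a"
    and \<iota> :: "'m mdeg \<Rightarrow> int \<Rightarrow> 'v \<Rightarrow> 'a"
begin

text \<open>
  Partial differentiation \<open>D\<close> with respect to the letter \<open>y\<close> is a derivation with \<open>D y = 1\<close>.  If
  \<open>y * x = 0\<close> then \<open>x + y * D x = 0\<close>, and differentiating again gives
  \<open>(c + 1) D\<^sup>c x + y * D\<^sup>c\<^sup>+\<^sup>1 x = 0\<close> for all \<open>c\<close>.  As \<open>D\<close> is locally nilpotent and the characteristic is
  \<open>0\<close>, all \<open>D\<^sup>c x\<close> vanish, by descending induction on \<open>c\<close>.
\<close>

lemma letter_degree_0_regular:
  assumes letter: "(e, -1, v) \<in> letters X" and "v \<noteq> 0" and "\<iota> e (-1) v * x = 0"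
  shows "x = 0"
proof -
  have cpx_e: "is_cpx (X e)" using letter cpx by (auto simp: letters_iff)
  interpret Xe: vector_space "scl (X e)" using cpx_e by (simp add: is_cpx_def)
  interpret K: vector_space "(*) :: 'k \<Rightarrow> 'k \<Rightarrow> 'k" by unfold_locales (simp_all add: algebra_simps)
  interpret XK: vector_space_pair "scl (X e)" "(*) :: 'k \<Rightarrow> 'k \<Rightarrow> 'k" ..
  have "Xe.independent {v}"
    using \<open>v \<noteq> 0\<close> Xe.independent_insertI[of v "{}"] by simp
  then obtain \<phi> where \<phi>: "Vector_Spaces.linear (scl (X e)) (*) \<phi>" "\<phi> v = 1"
    using XK.linear_independent_extend[of "{v}" "\<lambda>_. 1"] by auto
  interpret \<phi>: Vector_Spaces.linear "scl (X e)" "(*)" \<phi> by (rule \<phi>)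
  define g where "g d i u = (if d = e \<and> i = -1 then s (\<phi> u) 1 else 0)" for d and i :: int and u
  have "\<exists>\<theta>. linear_op \<theta> \<and> (\<forall>w\<in>words X. \<theta> (pr w) = word_deriv \<iota> 0 g w)"
    by (rule derivation_exists)
      (auto simp: g_def \<phi>.add \<phi>.scale scale_left_distrib koszul_sign_def mult_scale
        simp flip: scale_mult)
  then obtain D where D: "linear_op D" "\<forall>w\<in>words X. D (pr w) = word_deriv \<iota> 0 g w"
    by blast
  interpret D: Vector_Spaces.linear s s D by (rule D)
  let ?y = "\<iota> e (-1) v"
  have "D (pr [(e, -1, v)]) = word_deriv \<iota> 0 g [(e, -1, v)]"
    using D(2) letter by (simp del: word_prod_Cons word_deriv.simps)
  then have D_y: "D ?y = 1" by (simp add: g_def \<phi>(2))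
  have y_deg: "?y \<in> word_span (\<lambda>w. word_cdeg w = 0)"
    by (rule word_span_letter[OF letter]) simp
  have D_y_mult: "D (?y * a) = a + ?y * D a" for a
    using word_deriv_leibniz[OF D y_deg] by (simp add: D_y koszul_sign_def)
  \<comment> \<open>As \<open>D\<close> shortens words, \<open>y D + c\<close> is injective for \<open>c \<ge> 1\<close> by induction on length.\<close>
  have inj: "a = 0" if "a \<in> word_span (\<lambda>w. length w \<le> n)" "?y * D a + s (of_nat (Suc c)) a = 0"
    for n c a
    using that
  proof (induction n arbitrary: a c)
    case 0
    have "D a \<in> {0}"
      by (rule linear_op_word_span[OF D(1) _ _ 0(1)]) (use D(2) words_Nil in fastforce)+
    then show ?case using 0(2) by (simp del: of_nat_Suc)
  next
    case (Suc n)
    have "D a \<in> word_span (\<lambda>w. length w \<le> n)"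
    proof (rule linear_op_word_span[OF D(1) _ subspace_word_span Suc.prems(1)])
      fix w assume w: "w \<in> words X" "length w \<le> Suc n"
      have "word_deriv \<iota> 0 g w \<in> word_span (\<lambda>u. length w = Suc (length u))"
        by (rule word_deriv_in_word_span[where Q = "\<lambda>l u. u = []"])
          (use w word_span_base[of "[]" "\<lambda>u. u = []"] in
            \<open>auto simp: g_def subspace_0 subspace_scale subspace_word_span\<close>)
      also have "\<dots> \<subseteq> word_span (\<lambda>u. length u \<le> n)"
        by (rule word_span_mono) (use w in auto)
      finally show "D (pr w) \<in> word_span (\<lambda>w. length w \<le> n)"
        using w D(2) by simp
    qed
    moreover have "?y * D (D a) + s (of_nat (Suc (Suc c))) (D a) = 0"
    proof -
      have "D (?y * D a + s (of_nat (Suc c)) a) = 0"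
        using Suc.prems(2) by simp
      moreover have "s (of_nat (Suc (Suc c))) (D a) = D a + s (of_nat (Suc c)) (D a)"
        using scale_left_distrib[of 1 "of_nat (Suc c)" "D a"] by simp
      ultimately show ?thesis
        by (simp add: D.add D.scale D_y_mult ac_simps del: of_nat_Suc)
    qed
    ultimately have "D a = 0" using Suc.IH by blast
    then show ?case using Suc.prems(2) by (simp del: of_nat_Suc)
  qed
  have "\<exists>n. x \<in> word_span (\<lambda>w. length w \<le> n)"
  proof -
    have "x \<in> span (pr ` words X)" using span_words by simp
    then show ?thesis
    proof (induction rule: span_induct_alt)
      case base
      then show ?case by (auto simp: subspace_word_span subspace_0)
    next
      case (step c z x)
      then obtain n w where n: "x \<in> word_span (\<lambda>w. length w \<le> n)" and w: "w \<in> words X" "z = pr w"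
        by blast
      let ?N = "max n (length w)"
      have "word_span (\<lambda>w. length w \<le> n) \<subseteq> word_span (\<lambda>w. length w \<le> ?N)"
        by (rule word_span_mono) simp
      with n have "x \<in> word_span (\<lambda>w. length w \<le> ?N)"
        by blast
      moreover have "z \<in> word_span (\<lambda>w. length w \<le> ?N)"
        using w by (simp add: word_span_base)
      ultimately show ?case
        by (meson subspace_add subspace_scale subspace_word_span)
    qed
  qed
  moreover have "?y * D x + s (of_nat (Suc 0)) x = 0"
    using D_y_mult[of x] assms(3) by (simp add: add.commute)
  ultimately show ?thesis using inj by blast
qed

end

section \<open>The Laplacian of a coLie-coalgebra\<close>

locale coLie_coalgebra =
  fixes \<aa> :: "('k::field_char_0, 'm::finite, 'v::ab_group_add, 'a::ring_1) coLie"
  assumes coLie: "is_coLie \<aa>"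

sublocale coLie_coalgebra \<subseteq> symmetric_algebra_char_0 "und \<aa>" "smul \<aa>" "incl \<aa>"
  using coLie by unfold_locales (simp_all add: is_coLie_def)

context coLie_coalgebra
begin

abbreviation homogeneous :: "'m mdeg \<Rightarrow> int \<Rightarrow> ('m, 'v) letter list \<Rightarrow> bool" where
  "homogeneous d n w \<equiv> word_mdeg w = d \<and> word_cdeg w = n"

lemma sym_part_eq: "sym_part \<aa> d n = word_span (homogeneous d n)"
  by (simp add: sym_part_def word_span_def)

lemma decomposables_eq: "decomposables \<aa> d n = word_span (\<lambda>w. 2 \<le> length w \<and> homogeneous d n w)"
  by (simp add: decomposables_def word_span_def)

lemma subspace_sym_part: "subspace (sym_part \<aa> d n)"
  by (simp add: sym_part_eq subspace_word_span)

lemma sym_part_mult: "x \<in> sym_part \<aa> d n \<Longrightarrow> y \<in> sym_part \<aa> e m \<Longrightarrow> x * y \<in> sym_part \<aa> (d + e) (n + m)"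
  unfolding sym_part_eq by (rule word_span_mult) auto

lemma incl_sym_part: "(d, i, v) \<in> letters (und \<aa>) \<Longrightarrow> incl \<aa> d i v \<in> sym_part \<aa> d (i + 1)"
  unfolding sym_part_eq by (rule word_span_letter) auto

text \<open>
  Letters have nonzero multidegree, so the filtration by word length is finite in each multidegree.
\<close>

lemma length_le_word_mdeg: "w \<in> words (und \<aa>) \<Longrightarrow> length w \<le> sum (word_mdeg w) UNIV"
proof (induction w)
  case (Cons l w)
  obtain d i v where l: "l = (d, i, v)" by (cases l)
  have "d \<noteq> 0" using Cons.prems by (simp add: l letters_iff)
  then obtain j where "d j \<noteq> 0" by (auto simp: fun_eq_iff)
  then have "1 \<le> sum d UNIV" using member_le_sum[of j UNIV d] by simp
  then show ?case using Cons by (simp add: l sum.distrib)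
qed simp

lemma linear_codif: "linear_op (codif \<aa>)"
  using coLie by (simp add: is_coLie_def)

lemma codif_sym_part: "x \<in> sym_part \<aa> d n \<Longrightarrow> codif \<aa> x \<in> sym_part \<aa> d (n + 1)"
  using coLie by (fastforce simp: is_coLie_def)

lemma codif_leibniz:
  "x \<in> sym_part \<aa> d n \<Longrightarrow> codif \<aa> (x * y) = codif \<aa> x * y + koszul_sign n * (x * codif \<aa> y)"
  using coLie unfolding is_coLie_def by blast

lemma codif_codif: "codif \<aa> (codif \<aa> x) = 0"
  using coLie by (simp add: is_coLie_def)

lemma codif_incl:
  "(d, i, v) \<in> letters (und \<aa>) \<Longrightarrow>
    codif \<aa> (incl \<aa> d i v) + incl \<aa> d (i + 1) (dif (und \<aa> d) i v) \<in> decomposables \<aa> d (i + 2)"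
  using coLie unfolding is_coLie_def by blast

end

locale contracted_coLie = coLie_coalgebra \<aa>
  for \<aa> :: "('k::field_char_0, 'm::finite, 'v::ab_group_add, 'a::ring_1) coLie" +
  fixes harm acyc :: "'m mdeg \<Rightarrow> int \<Rightarrow> 'v set" and \<sigma> :: "'m mdeg \<Rightarrow> int \<Rightarrow> 'v \<Rightarrow> 'v"
  assumes contraction: "d \<noteq> 0 \<Longrightarrow> cochain_complex.contraction (und \<aa> d) (harm d) (acyc d) (\<sigma> d)"
begin

lemma
  assumes "d \<noteq> 0"
  shows harm_cocycles: "harm d i \<subseteq> cocycles (und \<aa> d) i"
    and acyc_obj: "acyc d i \<subseteq> obj (und \<aa> d) i"
    and decomposition: "x \<in> obj (und \<aa> d) i \<Longrightarrow> \<exists>h\<in>harm d i. \<exists>a\<in>acyc d i. x = h + a"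
    and \<sigma>_linear: "linear_map_on (obj (und \<aa> d) i) (scl (und \<aa> d)) (scl (und \<aa> d)) (\<sigma> d i)"
    and \<sigma>_obj: "x \<in> obj (und \<aa> d) i \<Longrightarrow> \<sigma> d i x \<in> obj (und \<aa> d) (i - 1)"
    and \<sigma>_harm: "h \<in> harm d i \<Longrightarrow> \<sigma> d i h = 0"
    and \<sigma>_acyc: "a \<in> acyc d i \<Longrightarrow>
      dif (und \<aa> d) (i - 1) (\<sigma> d i a) + \<sigma> d (i + 1) (dif (und \<aa> d) i a) = a"
proof -
  interpret Xd: cochain_complex "und \<aa> d" by (rule is_cpx_cochain_complex[OF cpx[OF assms]])
  show "harm d i \<subseteq> cocycles (und \<aa> d) i" "acyc d i \<subseteq> obj (und \<aa> d) i"
    "x \<in> obj (und \<aa> d) i \<Longrightarrow> \<exists>h\<in>harm d i. \<exists>a\<in>acyc d i. x = h + a"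
    "linear_map_on (obj (und \<aa> d) i) (scl (und \<aa> d)) (scl (und \<aa> d)) (\<sigma> d i)"
    "x \<in> obj (und \<aa> d) i \<Longrightarrow> \<sigma> d i x \<in> obj (und \<aa> d) (i - 1)"
    "h \<in> harm d i \<Longrightarrow> \<sigma> d i h = 0"
    "a \<in> acyc d i \<Longrightarrow> dif (und \<aa> d) (i - 1) (\<sigma> d i a) + \<sigma> d (i + 1) (dif (und \<aa> d) i a) = a"
    using contraction[OF assms] unfolding Xd.contraction_def by blast+
qed

text \<open>
  Letters that the Laplacian, modulo longer words, kills and fixes respectively.  A letter with vector
  \<open>0\<close> may be of both kinds, in which case it counts as acyclic.
\<close>

definition harmonic_letter :: "('m, 'v) letter \<Rightarrow> bool" where
  "harmonic_letter = (\<lambda>(d, i, v). d \<noteq> 0 \<and> v \<in> harm d i)"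

definition acyclic_letter :: "('m, 'v) letter \<Rightarrow> bool" where
  "acyclic_letter = (\<lambda>(d, i, v). d \<noteq> 0 \<and> v \<in> acyc d i)"

definition pure :: "('m, 'v) letter list \<Rightarrow> bool" where
  "pure w \<longleftrightarrow> (\<forall>l\<in>set w. harmonic_letter l \<or> acyclic_letter l)"

definition acyclic_count :: "('m, 'v) letter list \<Rightarrow> nat" where
  "acyclic_count w = length (filter acyclic_letter w)"

lemma dif_letter: "(d, i, v) \<in> letters (und \<aa>) \<Longrightarrow> (d, i + 1, dif (und \<aa> d) i v) \<in> letters (und \<aa>)"
  using cpx by (fastforce simp: letters_iff is_cpx_def)

lemma \<sigma>_letter: "(d, i, v) \<in> letters (und \<aa>) \<Longrightarrow> (d, i - 1, \<sigma> d i v) \<in> letters (und \<aa>)"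
  using \<sigma>_obj by (auto simp: letters_iff)

lemma harmonic_letter_letters: "harmonic_letter l \<Longrightarrow> l \<in> letters (und \<aa>)"
  using harm_cocycles by (fastforce simp: harmonic_letter_def letters_def cocycles_def)

lemma acyclic_letter_letters: "acyclic_letter l \<Longrightarrow> l \<in> letters (und \<aa>)"
  using acyc_obj by (fastforce simp: acyclic_letter_def letters_def)

lemma pure_words: "pure w \<Longrightarrow> w \<in> words (und \<aa>)"
  using harmonic_letter_letters acyclic_letter_letters by (auto simp: pure_def words_def)

lemma incl_0:
  assumes "d \<noteq> 0"
  shows "incl \<aa> d i 0 = 0"
proof -
  interpret Xd: cochain_complex "und \<aa> d" by (rule is_cpx_cochain_complex[OF cpx[OF assms]])
  have "(d, i, 0) \<in> letters (und \<aa>)" using assms by (simp add: letters_iff)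
  from incl_add[OF this this] show ?thesis by simp
qed

lemma pure_spanning:
  "w \<in> words (und \<aa>) \<Longrightarrow>
    pr w \<in> word_span (\<lambda>u. pure u \<and> length u = length w \<and> homogeneous (word_mdeg w) (word_cdeg w) u)"
proof (induction w)
  case Nil
  show ?case
    by (rule word_span_base) (simp_all add: pure_def)
next
  case (Cons l w)
  obtain d i v where l: "l = (d, i, v)" by (cases l)
  have dv: "d \<noteq> 0" "v \<in> obj (und \<aa> d) i" using Cons.prems by (auto simp: l letters_iff)
  obtain h a where ha: "h \<in> harm d i" "a \<in> acyc d i" "v = h + a"
    using decomposition[OF dv] by blast
  let ?P = "\<lambda>u. pure u \<and> length u = 1 \<and> homogeneous d (i + 1) u"
  have "harmonic_letter (d, i, h)" "acyclic_letter (d, i, a)"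
    using ha dv by (auto simp: harmonic_letter_def acyclic_letter_def)
  moreover from this have "(d, i, h) \<in> letters (und \<aa>)" "(d, i, a) \<in> letters (und \<aa>)"
    by (auto intro: harmonic_letter_letters acyclic_letter_letters)
  ultimately have "incl \<aa> d i h \<in> word_span ?P" "incl \<aa> d i a \<in> word_span ?P"
      "incl \<aa> d i v = incl \<aa> d i h + incl \<aa> d i a"
    using incl_add ha by (auto intro!: word_span_letter simp: pure_def)
  then have "incl \<aa> d i v \<in> word_span ?P"
    by (simp add: subspace_add subspace_word_span)
  then have "incl \<aa> d i v * pr w \<in> word_span (\<lambda>u. pure u \<and> length u = length (l # w) \<and> 
      homogeneous (word_mdeg (l # w)) (word_cdeg (l # w)) u)"
    by (rule word_span_mult[where Q = "\<lambda>u. pure u \<and> length u = length w \<and> homogeneous (word_mdeg w) (word_cdeg w) u",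
          rotated]) (use Cons in \<open>auto simp: l pure_def\<close>)
  then show ?case by (simp only: l word_prod_Cons)
qed

text \<open>
  The differential of \<open>X[-1]\<close> is minus that of \<open>X\<close>, so the homotopy carries a sign as well: the two
  signs cancel in the Laplacian.
\<close>

lemma homotopy_exists:
  "\<exists>\<theta>. linear_op \<theta> \<and> (\<forall>w\<in>words (und \<aa>). \<theta> (pr w) =
     word_deriv (incl \<aa>) 1 (\<lambda>d i v. - incl \<aa> d (i - 1) (\<sigma> d i v)) w)"
proof (rule derivation_exists)
  fix d i u v c
  assume u: "(d, i, u) \<in> letters (und \<aa>)"
  then have lin: "linear_map_on (obj (und \<aa> d) i) (scl (und \<aa> d)) (scl (und \<aa> d)) (\<sigma> d i)"
    using \<sigma>_linear by (simp add: letters_iff)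
  show "- incl \<aa> d (i - 1) (\<sigma> d i (scl (und \<aa> d) c u)) = smul \<aa> c (- incl \<aa> d (i - 1) (\<sigma> d i u))"
    using lin u incl_scale[OF \<sigma>_letter[OF u]] by (simp add: linear_map_on_def letters_iff)
  assume v: "(d, i, v) \<in> letters (und \<aa>)"
  show "- incl \<aa> d (i - 1) (\<sigma> d i (u + v)) =
      - incl \<aa> d (i - 1) (\<sigma> d i u) + - incl \<aa> d (i - 1) (\<sigma> d i v)"
    using lin u v incl_add[OF \<sigma>_letter[OF u] \<sigma>_letter[OF v]] by (simp add: linear_map_on_def letters_iff)
next
  fix d i u e j v
  assume u: "(d, i, u) \<in> letters (und \<aa>)" and v: "(e, j, v) \<in> letters (und \<aa>)"
  show "- incl \<aa> d (i - 1) (\<sigma> d i u) * incl \<aa> e j v =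
      koszul_sign ((i + 1 + 1) * (j + 1)) * (incl \<aa> e j v * - incl \<aa> d (i - 1) (\<sigma> d i u))"
    using incl_commute[OF \<sigma>_letter[OF u] v] by (simp add: koszul_sign_def)
qed

definition htpy :: "'a \<Rightarrow> 'a" where
  "htpy = (SOME \<theta>. linear_op \<theta> \<and> (\<forall>w\<in>words (und \<aa>). \<theta> (pr w) =
     word_deriv (incl \<aa>) 1 (\<lambda>d i v. - incl \<aa> d (i - 1) (\<sigma> d i v)) w))"

lemma linear_htpy: "linear_op htpy"
  and htpy_word: "w \<in> words (und \<aa>) \<Longrightarrow>
    htpy (pr w) = word_deriv (incl \<aa>) 1 (\<lambda>d i v. - incl \<aa> d (i - 1) (\<sigma> d i v)) w"
  using someI_ex[OF homotopy_exists] unfolding htpy_def by blast+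

lemma htpy_incl: "(d, i, v) \<in> letters (und \<aa>) \<Longrightarrow> htpy (incl \<aa> d i v) = - incl \<aa> d (i - 1) (\<sigma> d i v)"
  using htpy_word[of "[(d, i, v)]"] by simp

lemma htpy_leibniz:
  assumes "x \<in> sym_part \<aa> d n"
  shows "htpy (x * y) = htpy x * y + koszul_sign n * (x * htpy y)"
proof -
  have "x \<in> word_span (\<lambda>w. word_cdeg w = n)"
    using assms word_span_mono[of "homogeneous d n" "\<lambda>w. word_cdeg w = n"] by (auto simp: sym_part_eq)
  from word_deriv_leibniz[OF linear_htpy ballI[OF htpy_word] this] show ?thesis by simp
qed

lemma htpy_word_span:
  assumes "w \<in> words (und \<aa>)"
  shows "htpy (pr w) \<in> word_span (\<lambda>u. length u = length w \<and> homogeneous (word_mdeg w) (word_cdeg w - 1) u)"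
  unfolding htpy_word[OF assms]
proof (rule word_deriv_in_word_span[where Q = "\<lambda>(d, i, v) u. length u = 1 \<and> homogeneous d i u", OF _ _ _ assms])
  fix d i v assume "(d, i, v) \<in> letters (und \<aa>)"
  from \<sigma>_letter[OF this]
  show "- incl \<aa> d (i - 1) (\<sigma> d i v) \<in> word_span ((\<lambda>(d, i, v) u. length u = 1 \<and> homogeneous d i u) (d, i, v))"
    by (auto intro!: subspace_neg[OF subspace_word_span] word_span_letter)
qed auto

lemma htpy_sym_part: "x \<in> sym_part \<aa> d n \<Longrightarrow> htpy x \<in> sym_part \<aa> d (n - 1)"
  unfolding sym_part_eq
proof (erule linear_op_word_span[OF linear_htpy _ subspace_word_span, rotated])
  fix w assume w: "w \<in> words (und \<aa>)" "homogeneous d n w"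
  have "word_span (\<lambda>u. length u = length w \<and> homogeneous (word_mdeg w) (word_cdeg w - 1) u)
      \<subseteq> word_span (homogeneous d (n - 1))"
    by (rule word_span_mono) (use w in auto)
  then show "htpy (pr w) \<in> word_span (homogeneous d (n - 1))"
    using htpy_word_span[OF w(1)] by blast
qed

lemma htpy_decomposables: "x \<in> decomposables \<aa> d n \<Longrightarrow> htpy x \<in> decomposables \<aa> d (n - 1)"
  unfolding decomposables_eq
proof (erule linear_op_word_span[OF linear_htpy _ subspace_word_span, rotated])
  fix w assume w: "w \<in> words (und \<aa>)" "2 \<le> length w \<and> homogeneous d n w"
  have "word_span (\<lambda>u. length u = length w \<and> homogeneous (word_mdeg w) (word_cdeg w - 1) u)
      \<subseteq> word_span (\<lambda>w. 2 \<le> length w \<and> homogeneous d (n - 1) w)"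
    by (rule word_span_mono) (use w in auto)
  then show "htpy (pr w) \<in> word_span (\<lambda>w. 2 \<le> length w \<and> homogeneous d (n - 1) w)"
    using htpy_word_span[OF w(1)] by blast
qed

definition laplacian :: "'a \<Rightarrow> 'a" where
  "laplacian x = codif \<aa> (htpy x) + htpy (codif \<aa> x)"

lemma linear_laplacian: "linear_op laplacian"
proof -
  interpret c: Vector_Spaces.linear "smul \<aa>" "smul \<aa>" "codif \<aa>" by (rule linear_codif)
  interpret h: Vector_Spaces.linear "smul \<aa>" "smul \<aa>" htpy by (rule linear_htpy)
  show ?thesis
    by unfold_locales (simp_all add: laplacian_def c.add c.scale h.add h.scale scale_right_distrib)
qed

text \<open>
  The graded commutator of two derivations of odd degree is a derivation of even degree.
\<close>

lemma laplacian_leibniz: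
  assumes x: "x \<in> sym_part \<aa> d n"
  shows "laplacian (x * y) = laplacian x * y + x * laplacian y"
proof -
  interpret c: Vector_Spaces.linear "smul \<aa>" "smul \<aa>" "codif \<aa>" by (rule linear_codif)
  interpret h: Vector_Spaces.linear "smul \<aa>" "smul \<aa>" htpy by (rule linear_htpy)
  show ?thesis
    unfolding laplacian_def htpy_leibniz[OF x] codif_leibniz[OF x]
    by (cases "even n")
      (simp_all add: c.add h.add c.diff h.diff c.neg h.neg codif_leibniz[OF x] htpy_leibniz[OF x] codif_leibniz[OF htpy_sym_part[OF x]]
        htpy_leibniz[OF codif_sym_part[OF x]] koszul_sign_even koszul_sign_odd algebra_simps)
qed

lemma laplacian_letter:
  assumes l: "(d, i, v) \<in> letters (und \<aa>)" 
  shows "laplacian (incl \<aa> d i v) - incl \<aa> d i (dif (und \<aa> d) (i - 1) (\<sigma> d i v) + \<sigma> d (i + 1) (dif (und \<aa> d) i v))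
    \<in> decomposables \<aa> d (i + 1)"
proof -
  interpret c: Vector_Spaces.linear "smul \<aa>" "smul \<aa>" "codif \<aa>" by (rule linear_codif)
  interpret h: Vector_Spaces.linear "smul \<aa>" "smul \<aa>" htpy by (rule linear_htpy)
  let ?dec = "decomposables \<aa> d (i + 1)"
  have dec: "subspace ?dec" by (simp add: decomposables_eq subspace_word_span)
  let ?x = "codif \<aa> (incl \<aa> d (i - 1) (\<sigma> d i v)) + incl \<aa> d i (dif (und \<aa> d) (i - 1) (\<sigma> d i v))"
  let ?y = "codif \<aa> (incl \<aa> d i v) + incl \<aa> d (i + 1) (dif (und \<aa> d) i v)"
  have "?x \<in> ?dec"
    using codif_incl[OF \<sigma>_letter[OF l]] by (simp add: add.commute)
  moreover have "htpy ?y \<in> ?dec"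
    using htpy_decomposables[OF codif_incl[OF l]] by (simp add: add.commute)
  ultimately have "htpy ?y - ?x \<in> ?dec"
    by (intro subspace_diff[OF dec])
  moreover have "incl \<aa> d i (dif (und \<aa> d) (i - 1) (\<sigma> d i v) + \<sigma> d (i + 1) (dif (und \<aa> d) i v)) = 
      incl \<aa> d i (dif (und \<aa> d) (i - 1) (\<sigma> d i v)) + incl \<aa> d i (\<sigma> d (i + 1) (dif (und \<aa> d) i v))"
    using dif_letter[OF \<sigma>_letter[OF l]] \<sigma>_letter[OF dif_letter[OF l]] by (simp add: incl_add)
  moreover have "htpy (incl \<aa> d (i + 1) (dif (und \<aa> d) i v)) = - incl \<aa> d i (\<sigma> d (i + 1) (dif (und \<aa> d) i v))"
    using htpy_incl[OF dif_letter[OF l]] by simp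
  ultimately show ?thesis
    unfolding laplacian_def htpy_incl[OF l] h.add c.neg by (simp add: algebra_simps)
qed

text \<open>
  Words are approximate eigenvectors: by the Leibniz rule the Laplacian acts letter by letter, and the
  decomposable corrections on the letters lengthen the word.
\<close>

lemma laplacian_pure_word:
  assumes "pure w"
  shows "laplacian (pr w) - smul \<aa> (of_nat (acyclic_count w)) (pr w) \<in>
    word_span (\<lambda>u. length w < length u \<and> homogeneous (word_mdeg w) (word_cdeg w) u)"
  using assms
proof (induction w)
  case Nil
  interpret c: Vector_Spaces.linear "smul \<aa>" "smul \<aa>" "codif \<aa>" by (rule linear_codif)
  have "htpy 1 = 0" using htpy_word[of "[]"] by simp
  have "(1::'a) \<in> sym_part \<aa> 0 0"
    using word_span_base[of "[]"] by (simp add: sym_part_eq)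
  from codif_leibniz[OF this, of 1] have "codif \<aa> 1 = 0" 
    by (simp add: koszul_sign_def)
  interpret h: Vector_Spaces.linear "smul \<aa>" "smul \<aa>" htpy by (rule linear_htpy)
  have "htpy 0 = 0" by simp
  then show ?case
    using \<open>htpy 1 = 0\<close> \<open>codif \<aa> 1 = 0\<close> 
    by (simp add: laplacian_def acyclic_count_def subspace_0 subspace_word_span)
next
  case (Cons l w)
  obtain d i v where l: "l = (d, i, v)" by (cases l)
  let ?j = "if acyclic_letter l then 1 else 0 :: 'k"
  have pure_l: "harmonic_letter l \<or> acyclic_letter l" and "pure w" using Cons.prems by (auto simp: pure_def)
  then have letter: "(d, i, v) \<in> letters (und \<aa>)" using l harmonic_letter_letters acyclic_letter_letters by blast
  then have "d \<noteq> 0" by (simp add: letters_iff)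
  let ?R = "word_span (\<lambda>u. length (l # w) < length u \<and> homogeneous (word_mdeg (l # w)) (word_cdeg (l # w)) u)"
  have T: "incl \<aa> d i (dif (und \<aa> d) (i - 1) (\<sigma> d i v) + \<sigma> d (i + 1) (dif (und \<aa> d) i v)) = smul \<aa> ?j (incl \<aa> d i v)"
  proof (cases "acyclic_letter l")
    case True
    then show ?thesis using \<sigma>_acyc by (simp add: l acyclic_letter_def)
  next
    case False
    then have v: "v \<in> harm d i" using pure_l by (simp add: l harmonic_letter_def)
    interpret Xd: cochain_complex "und \<aa> d" by (rule is_cpx_cochain_complex[OF cpx[OF \<open>d \<noteq> 0\<close>]])
    have "dif (und \<aa> d) i v = 0" using v harm_cocycles[OF \<open>d \<noteq> 0\<close>] by (auto simp: cocycles_def)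
    moreover have "\<sigma> d (i + 1) 0 = 0"
      by (rule Xd.linear_map_on_0[OF \<sigma>_linear[OF \<open>d \<noteq> 0\<close>]])
    ultimately show ?thesis using False v \<sigma>_harm[OF \<open>d \<noteq> 0\<close>] incl_0[OF \<open>d \<noteq> 0\<close>] by simp
  qed
  have "(laplacian (incl \<aa> d i v) - smul \<aa> ?j (incl \<aa> d i v)) * pr w \<in> ?R"
    by (rule word_span_mult[where P = "\<lambda>u. 2 \<le> length u \<and> homogeneous d (i + 1) u" and Q = "\<lambda>u. u = w"])
      (use laplacian_letter[OF letter] T pure_words[OF \<open>pure w\<close>] in
        \<open>auto simp: l decomposables_eq intro!: word_span_base\<close>)
  moreover have "incl \<aa> d i v * (laplacian (pr w) - smul \<aa> (of_nat (acyclic_count w)) (pr w)) \<in> ?R"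
    by (rule word_span_mult[where P = "\<lambda>u. u = [l]", OF _ _ Cons.IH[OF \<open>pure w\<close>]])
      (use letter in \<open>auto simp: l intro: word_span_letter\<close>)
  ultimately have "(laplacian (incl \<aa> d i v) - smul \<aa> ?j (incl \<aa> d i v)) * pr w
      + incl \<aa> d i v * (laplacian (pr w) - smul \<aa> (of_nat (acyclic_count w)) (pr w)) \<in> ?R"
    by (intro subspace_add[OF subspace_word_span])
  also have "(laplacian (incl \<aa> d i v) - smul \<aa> ?j (incl \<aa> d i v)) * pr w
      + incl \<aa> d i v * (laplacian (pr w) - smul \<aa> (of_nat (acyclic_count w)) (pr w))
    = laplacian (pr (l # w)) - smul \<aa> (of_nat (acyclic_count (l # w))) (pr (l # w))"
    using laplacian_leibniz[OF incl_sym_part[OF letter]]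
    by (simp add: l acyclic_count_def algebra_simps scale_mult[symmetric] mult_scale scale_left_distrib)
  finally show ?case .
qed


section \<open>Vanishing of cohomology modulo a unit class\<close>

text \<open>
  Let \<open>M\<close> be the space of cocycles modulo \<open>y\<close> and \<open>N\<close> that of multiples of \<open>y\<close> plus coboundaries, so
  that \<open>M / N\<close> is the cohomology of the quotient by \<open>y\<close>.  The Laplacian acts as zero on \<open>M / N\<close>, since
  the homotopy commutes with multiplication by \<open>y\<close>.  Filter by word length \<open>p\<close> and then by the number
  \<open>q\<close> of acyclic letters: for \<open>q > 0\<close> the operator \<open>1 - laplacian / q\<close> lowers the filtration and is the
  identity on \<open>M / N\<close>, while for \<open>q = 0\<close> the words of length \<open>p\<close> are multiples of \<open>y\<close> by hypothesis.
  Hence an element of \<open>M\<close> can be moved, modulo \<open>N\<close>, into ever deeper steps of the filtration, which is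
  finite.
\<close>

lemma cocycle_mod_y_is_boundary_mod_y:
  fixes u :: 'v and f :: "'m mdeg"
  assumes u: "harmonic_letter (f, -1, u)" and codif_y: "codif \<aa> (incl \<aa> f (-1) u) = 0"
    and words: "\<And>w. \<forall>l\<in>set w. harmonic_letter l \<Longrightarrow> homogeneous (f + d) n w \<Longrightarrow>
      \<exists>a\<in>sym_part \<aa> d n. pr w = incl \<aa> f (-1) u * a"
    and z: "z \<in> sym_part \<aa> (f + d) n" "b \<in> sym_part \<aa> d (n + 1)" "codif \<aa> z = incl \<aa> f (-1) u * b"
  shows "\<exists>a\<in>sym_part \<aa> d n. \<exists>x\<in>sym_part \<aa> (f + d) (n - 1). z = incl \<aa> f (-1) u * a + codif \<aa> x"
proof -
  interpret c: Vector_Spaces.linear "smul \<aa>" "smul \<aa>" "codif \<aa>" by (rule linear_codif)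
  interpret h: Vector_Spaces.linear "smul \<aa>" "smul \<aa>" htpy by (rule linear_htpy)
  interpret L: Vector_Spaces.linear "smul \<aa>" "smul \<aa>" laplacian by (rule linear_laplacian)
  let ?y = "incl \<aa> f (-1) u" and ?e = "f + d"
  define N where "N = {?y * a + codif \<aa> x |a x. a \<in> sym_part \<aa> d n \<and> x \<in> sym_part \<aa> ?e (n - 1)}"
  define M where "M = {z \<in> sym_part \<aa> ?e n. \<exists>b\<in>sym_part \<aa> d (n + 1). codif \<aa> z = ?y * b}"
  have letter: "(f, -1, u) \<in> letters (und \<aa>)" by (rule harmonic_letter_letters[OF u])
  have y: "?y \<in> sym_part \<aa> f 0" using incl_sym_part[OF letter] by simp
  have "htpy ?y = 0"
    using htpy_incl[OF letter] u \<sigma>_harm incl_0 by (simp add: harmonic_letter_def)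
  then have htpy_y: "htpy (?y * a) = ?y * htpy a" for a
    using htpy_leibniz[OF y] by (simp add: koszul_sign_def)
  have codif_y_mult: "codif \<aa> (?y * a) = ?y * codif \<aa> a" for a
    using codif_leibniz[OF y] codif_y by (simp add: koszul_sign_def)
  have y_mult: "?y * a \<in> sym_part \<aa> ?e m" if "a \<in> sym_part \<aa> d m" for a m
    using sym_part_mult[OF y that] by simp
  have codif_n: "codif \<aa> x \<in> sym_part \<aa> ?e n" if "x \<in> sym_part \<aa> ?e (n - 1)" for x
    using codif_sym_part[OF that] by simp
  have M: "subspace M"
  proof (rule subspaceI)
    show "0 \<in> M" unfolding M_def using subspace_sym_part
      by (auto simp: subspace_0 intro!: bexI[of _ 0])
    fix x x' c assume "x \<in> M"
    then obtain b where b: "x \<in> sym_part \<aa> ?e n" "b \<in> sym_part \<aa> d (n + 1)" "codif \<aa> x = ?y * b" by (auto simp: M_def)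
    show "smul \<aa> c x \<in> M"
      using b subspace_sym_part by (auto simp: M_def c.scale mult_scale subspace_scale intro!: bexI[of _ "smul \<aa> c b"])
    assume "x' \<in> M"
    then obtain b' where b': "x' \<in> sym_part \<aa> ?e n" "b' \<in> sym_part \<aa> d (n + 1)" "codif \<aa> x' = ?y * b'" by (auto simp: M_def)
    show "x + x' \<in> M"
      using b b' subspace_sym_part by (auto simp: M_def c.add distrib_left subspace_add intro!: bexI[of _ "b + b'"])
  qed
  have N: "subspace N"
  proof -
    have "subspace ((*) ?y ` sym_part \<aa> d n)" "subspace (codif \<aa> ` sym_part \<aa> ?e (n - 1))"
      using E.linear_subspace_image[OF linear_op_mult_left subspace_sym_part]
        E.linear_subspace_image[OF linear_codif subspace_sym_part] by auto
    from subspace_sums[OF this] show ?thesis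
      by (rule back_subst[of subspace]) (auto simp: N_def)
  qed
  have N_M: "N \<subseteq> M"
  proof
    fix z assume "z \<in> N"
    then obtain a x where a: "a \<in> sym_part \<aa> d n" "x \<in> sym_part \<aa> ?e (n - 1)" "z = ?y * a + codif \<aa> x"
      by (auto simp: N_def)
    have "codif \<aa> z = ?y * codif \<aa> a"
      by (simp add: a c.add codif_y_mult codif_codif)
    moreover have "z \<in> sym_part \<aa> ?e n"
      using a y_mult codif_n subspace_add[OF subspace_sym_part] by blast
    ultimately show "z \<in> M" using codif_sym_part[OF a(1)] by (auto simp: M_def)
  qed
  have laplacian_M: "laplacian z \<in> N" if zM: "z \<in> M" for z
  proof -
    obtain b where b: "z \<in> sym_part \<aa> ?e n" "b \<in> sym_part \<aa> d (n + 1)" "codif \<aa> z = ?y * b"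
      using zM by (auto simp: M_def)
    have "laplacian z = ?y * htpy b + codif \<aa> (htpy z)"
      by (simp add: laplacian_def b htpy_y)
    moreover have "htpy b \<in> sym_part \<aa> d n" "htpy z \<in> sym_part \<aa> ?e (n - 1)"
      using htpy_sym_part[OF b(2)] htpy_sym_part[OF b(1)] by simp_all
    ultimately show ?thesis by (auto simp: N_def)
  qed
  let ?G = "\<lambda>p q. word_span (\<lambda>w. pure w \<and> homogeneous ?e n w \<and> (p < length w \<or> length w = p \<and> acyclic_count w \<le> q))"
  have sym_part_G: "sym_part \<aa> ?e n \<subseteq> ?G 0 0"
    unfolding sym_part_eq
  proof (rule word_span_least[OF subspace_word_span])
    fix w assume w: "w \<in> words (und \<aa>)" "homogeneous ?e n w"
    have "word_span (\<lambda>u. pure u \<and> length u = length w \<and> homogeneous (word_mdeg w) (word_cdeg w) u) \<subseteq> ?G 0 0"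
      by (rule word_span_mono) (use w in \<open>auto simp: acyclic_count_def\<close>)
    then show "pr w \<in> ?G 0 0" using pure_spanning[OF w(1)] by blast
  qed
  \<comment> \<open>Words of length \<open>p\<close> with \<open>q + 1\<close> acyclic letters are eigenvectors modulo longer words.\<close>
  have step: "laplacian z - smul \<aa> (of_nat (Suc q)) z \<in> ?G p q" if "z \<in> ?G p (Suc q)" for z p q
  proof (rule linear_op_word_span[OF _ _ subspace_word_span that])
    show "linear_op (\<lambda>z. laplacian z - smul \<aa> (of_nat (Suc q)) z)"
      by unfold_locales (simp_all add: L.add L.scale scale_right_distrib scale_right_diff_distrib mult.commute del: of_nat_Suc)
    fix w assume w: "w \<in> words (und \<aa>)" 
      and P: "pure w \<and> homogeneous ?e n w \<and> (p < length w \<or> length w = p \<and> acyclic_count w \<le> Suc q)"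
    have "word_span (\<lambda>u. length w < length u \<and> homogeneous (word_mdeg w) (word_cdeg w) u) \<subseteq> ?G p q"
    proof (rule word_span_least[OF subspace_word_span])
      fix v assume v: "v \<in> words (und \<aa>)" "length w < length v \<and> homogeneous (word_mdeg w) (word_cdeg w) v"
      have "word_span (\<lambda>u. pure u \<and> length u = length v \<and> homogeneous (word_mdeg v) (word_cdeg v) u) \<subseteq> ?G p q"
        by (rule word_span_mono) (use v P in auto)
      then show "pr v \<in> ?G p q" using pure_spanning[OF v(1)] by blast
    qed
    then have "laplacian (pr w) - smul \<aa> (of_nat (acyclic_count w)) (pr w) \<in> ?G p q"
      using laplacian_pure_word P by blast
    moreover have "smul \<aa> (of_nat (acyclic_count w) - of_nat (Suc q)) (pr w) \<in> ?G p q"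
    proof (cases "length w = p \<and> acyclic_count w = Suc q")
      case True
      then show ?thesis using subspace_0[OF subspace_word_span] by simp
    next
      case False
      then have "pr w \<in> ?G p q" by (intro word_span_base w) (use P in auto)
      then show ?thesis by (rule subspace_scale[OF subspace_word_span])
    qed
    ultimately show "laplacian (pr w) - smul \<aa> (of_nat (Suc q)) (pr w) \<in> ?G p q"
      using subspace_add[OF subspace_word_span] by (fastforce simp: scale_left_diff_distrib simp del: of_nat_Suc)
  qed
  \<comment> \<open>As \<open>acyclic_count w \<le> length w\<close>, \<open>?G (Suc p) (Suc p)\<close> contains all words longer than \<open>p\<close>.\<close>
  have base: "\<exists>a\<in>sym_part \<aa> d n. z - ?y * a \<in> ?G (Suc p) (Suc p)" if zG: "z \<in> ?G p 0" for z p
  proof -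
    have "subspace {x + x' |x x'. x \<in> (*) ?y ` sym_part \<aa> d n \<and> x' \<in> ?G (Suc p) (Suc p)}" (is "subspace ?S")
      by (intro subspace_sums subspace_word_span E.linear_subspace_image[OF linear_op_mult_left subspace_sym_part])
    moreover have "pr w \<in> ?S" if w: "w \<in> words (und \<aa>)" 
      and P: "pure w \<and> homogeneous ?e n w \<and> (p < length w \<or> length w = p \<and> acyclic_count w \<le> 0)" for w
    proof (cases "p < length w")
      case True
      have "acyclic_count w \<le> length w" by (simp add: acyclic_count_def)
      then have "pr w \<in> ?G (Suc p) (Suc p)" by (intro word_span_base w) (use True P in auto)
      moreover have "?y * 0 \<in> (*) ?y ` sym_part \<aa> d n" using subspace_0[OF subspace_sym_part] by blast
      ultimately show ?thesis by force
    next
      case False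
      then have "\<forall>l\<in>set w. harmonic_letter l" using P by (auto simp: acyclic_count_def pure_def filter_empty_conv)
      then obtain a where "a \<in> sym_part \<aa> d n" "pr w = ?y * a" using words P by blast
      moreover have "0 \<in> ?G (Suc p) (Suc p)" by (rule subspace_0[OF subspace_word_span])
      ultimately show ?thesis by force
    qed
    ultimately have "?G p 0 \<subseteq> ?S" by (rule word_span_least)
    then obtain a x' where "a \<in> sym_part \<aa> d n" "x' \<in> ?G (Suc p) (Suc p)" "z = ?y * a + x'"
      using zG by blast
    then show ?thesis by (intro bexI[of _ a]) simp_all
  qed
  have main: "z \<in> N" if "z \<in> M" "z \<in> ?G p q" for z p q
    using that
  proof (induction "Suc (sum ?e UNIV) - p" arbitrary: p q z)
    case 0
    have "?G p q \<subseteq> {0}"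
      by (rule word_span_least) (use 0 length_le_word_mdeg in fastforce)+
    then have "z = 0" using 0(3) by blast
    then show ?case using subspace_0[OF N] by simp
  next
    case (Suc r)
    have IH: "z \<in> N" if "z \<in> M" "z \<in> ?G (Suc p) q" for z q
      by (rule Suc.hyps(1)[OF _ that]) (use Suc.hyps(2) in simp)
    show ?case
      using Suc.prems
    proof (induction q arbitrary: z)
      case 0
      obtain a where a: "a \<in> sym_part \<aa> d n" "z - ?y * a \<in> ?G (Suc p) (Suc p)"
        using base[OF 0(2)] by blast
      have "?y * a + codif \<aa> 0 \<in> N"
        using a(1) subspace_0[OF subspace_sym_part] by (auto simp: N_def simp del: c.zero)
      then have ya: "?y * a \<in> N" by simp
      then have "z - ?y * a \<in> M" using 0(1) N_M M subspace_diff by blast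
      then have "z - ?y * a \<in> N" using IH a(2) by blast
      then show ?case using ya N subspace_add by fastforce
    next
      case (Suc q)
      let ?L = "smul \<aa> (1 / of_nat (Suc q)) (laplacian z)"
      have L: "?L \<in> N" by (rule subspace_scale[OF N laplacian_M[OF Suc.prems(1)]])
      have "smul \<aa> (- 1 / of_nat (Suc q)) (laplacian z - smul \<aa> (of_nat (Suc q)) z) \<in> ?G p q"
        by (rule subspace_scale[OF subspace_word_span step[OF Suc.prems(2)]])
      also have "smul \<aa> (- 1 / of_nat (Suc q)) (laplacian z - smul \<aa> (of_nat (Suc q)) z) = z - ?L"
        by (simp add: scale_right_diff_distrib del: of_nat_Suc)
      finally have "z - ?L \<in> ?G p q" .
      moreover have "z - ?L \<in> M" using L Suc.prems(1) N_M M subspace_diff by blast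
      ultimately have "z - ?L \<in> N" using Suc.IH by blast
      then show ?case using L N subspace_add by fastforce
    qed
  qed
  have "z \<in> M" using z by (auto simp: M_def)
  then have "z \<in> N" using main sym_part_G z(1) by blast
  then show ?thesis by (auto simp: N_def)
qed

end

section \<open>The unit and the stabilization maps\<close>

lemma (in coLie_coalgebra) is_cpx_coChev_un: "is_cpx (coChev_un \<aa> d)"
proof -
  interpret c: Vector_Spaces.linear "smul \<aa>" "smul \<aa>" "codif \<aa>" by (rule linear_codif)
  show ?thesis
    using vector_space_axioms subspace_sym_part codif_sym_part codif_codif
    by (auto simp: is_cpx_def coChev_un_def linear_map_on_def c.add c.scale)
qed

lemma is_cpx_unit_cpx: "is_cpx (unit_cpx d :: ('k::field, 'm \<Rightarrow> 'k) cpx)"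
proof -
  interpret vector_space "\<lambda>(c::'k) (u :: 'm \<Rightarrow> 'k) k. c * u k"
    by unfold_locales (auto simp: fun_eq_iff algebra_simps)
  show ?thesis
    unfolding is_cpx_def unit_cpx_def
    using vector_space_axioms by (auto simp: linear_map_on_def subspace_def)
qed

lemma unit_deg_nonzero [simp]: "unit_deg k \<noteq> 0"
  by (auto simp: unit_deg_def fun_eq_iff)

lemma unit_deg_eq_iff: "unit_deg j = unit_deg k \<longleftrightarrow> j = k"
  by (auto simp: unit_deg_def fun_eq_iff split: if_splits)

locale strongly_unital_coLie = coLie_coalgebra \<aa>
  for \<aa> :: "('k::field_char_0, 'm::finite, 'v::ab_group_add, 'a::ring_1) coLie" +
  fixes \<eta> :: "'m mdeg \<Rightarrow> int \<Rightarrow> ('m \<Rightarrow> 'k) \<Rightarrow> 'v" and \<Phi> :: "('m mdeg \<Rightarrow>\<^sub>0 'k) \<Rightarrow> 'a"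
  assumes unit_map: "coLie_map unit_coLie \<aa> \<eta> \<Phi>"
    and strong: "strongly_unital \<aa> \<eta>"
begin

definition axis_vec :: "'m \<Rightarrow> 'm \<Rightarrow> 'k" where
  "axis_vec k = (\<lambda>j. if j = k then 1 else 0)"

definition unit_vec :: "'m \<Rightarrow> 'v" where
  "unit_vec k = \<eta> (unit_deg k) (-1) (axis_vec k)"

lemma unit_cochain_map:
  assumes "d \<noteq> 0"
  shows "cochain_map (unit_cpx d) (und \<aa> d) (\<eta> d)"
proof unfold_locales
  show "is_cpx (unit_cpx d :: ('k, 'm \<Rightarrow> 'k) cpx)" by (rule is_cpx_unit_cpx)
  show "is_cpx (und \<aa> d)" by (rule cpx[OF assms])
  show "chain_map (unit_cpx d) (und \<aa> d) (\<eta> d)"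
    using unit_map assms by (simp add: coLie_map_def unit_coLie_def)
qed

lemma axis_vec_cocycle: "axis_vec k \<in> cocycles (unit_cpx (unit_deg k)) (-1)"
  by (auto simp: cocycles_def unit_cpx_def axis_vec_def)

lemma coboundaries_unit_cpx: "coboundaries (unit_cpx d) i \<subseteq> {0}"
  by (auto simp: coboundaries_def unit_cpx_def)

lemma unit_vec_cocycle: "unit_vec k \<in> cocycles (und \<aa> (unit_deg k)) (-1)"
proof -
  interpret \<eta>: cochain_map "unit_cpx (unit_deg k)" "und \<aa> (unit_deg k)" "\<eta> (unit_deg k)"
    by (rule unit_cochain_map[OF unit_deg_nonzero])
  show ?thesis unfolding unit_vec_def by (rule \<eta>.map_cocycles[OF axis_vec_cocycle])
qed

lemma unit_vec_not_coboundary: "unit_vec k \<notin> coboundaries (und \<aa> (unit_deg k)) (-1)"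
proof
  assume bd: "unit_vec k \<in> coboundaries (und \<aa> (unit_deg k)) (-1)"
  interpret \<eta>: cochain_map "unit_cpx (unit_deg k)" "und \<aa> (unit_deg k)" "\<eta> (unit_deg k)"
    by (rule unit_cochain_map[OF unit_deg_nonzero])
  have "inj_on (coh_map (und \<aa> (unit_deg k)) (\<eta> (unit_deg k)) (-1)) (coh (unit_cpx (unit_deg k)) (-1))"
    using strong by (auto simp: strongly_unital_def unit_coLie_def bij_betw_def)
  then have "axis_vec k \<in> coboundaries (unit_cpx (unit_deg k)) (-1)"
    unfolding \<eta>.inj_on_coh_map_iff using axis_vec_cocycle bd by (auto simp: unit_vec_def)
  then have "axis_vec k = 0" using coboundaries_unit_cpx by blast
  then have "axis_vec k k = 0" by simp
  then show False by (simp add: axis_vec_def)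
qed

text \<open>
  By strong unitality the classes of the \<open>unit_vec j\<close> span the cohomology in degree \<open>-1\<close>.
\<close>

lemma cocycle_degree_minus_1:
  assumes d: "d \<noteq> 0" and v: "v \<in> cocycles (und \<aa> d) (-1)" "v \<notin> coboundaries (und \<aa> d) (-1)"
  shows "\<exists>j c. d = unit_deg j \<and> v - scl (und \<aa> d) c (unit_vec j) \<in> coboundaries (und \<aa> d) (-1)"
proof -
  interpret \<eta>: cochain_map "unit_cpx d" "und \<aa> d" "\<eta> d" by (rule unit_cochain_map[OF d])
  have "coh_map (und \<aa> d) (\<eta> d) (-1) ` coh (unit_cpx d) (-1) = coh (und \<aa> d) (-1)"
    using strong d by (auto simp: strongly_unital_def unit_coLie_def bij_betw_def)
  then obtain x where x: "x \<in> cocycles (unit_cpx d) (-1)" "v - \<eta> d (-1) x \<in> coboundaries (und \<aa> d) (-1)"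
    unfolding \<eta>.coh_map_surj_iff using v(1) by blast
  have "x \<noteq> 0" using x(2) v(2) by auto
  then obtain j where j: "x j \<noteq> 0" by (auto simp: fun_eq_iff)
  then have dj: "d = unit_deg j" using x(1) by (auto simp: cocycles_def unit_cpx_def)
  have "x i = 0" if "i \<noteq> j" for i
    using x(1) that by (simp add: cocycles_def unit_cpx_def dj unit_deg_eq_iff)
  then have "x = scl (unit_cpx d) (x j) (axis_vec j)"
    by (auto simp: unit_cpx_def axis_vec_def fun_eq_iff)
  moreover have "axis_vec j \<in> obj (unit_cpx d) (-1)"
    using axis_vec_cocycle by (auto simp: cocycles_def dj)
  ultimately have "\<eta> d (-1) x = scl (und \<aa> d) (x j) (unit_vec j)"
    using \<eta>.map_linear[of "-1"] unfolding linear_map_on_def unit_vec_def dj by metis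
  then show ?thesis using x(2) dj by auto
qed

lemma unit_vec_letter: "(unit_deg k, -1, unit_vec k) \<in> letters (und \<aa>)"
  using unit_vec_cocycle[of k] by (auto simp: letters_iff cocycles_def)

lemma axis_vec_letter:
  "(unit_deg k, -1, axis_vec k) \<in> letters (und (unit_coLie :: ('k, 'm, 'm \<Rightarrow> 'k, 'm mdeg \<Rightarrow>\<^sub>0 'k) coLie))"
  using axis_vec_cocycle[of k] by (auto simp: letters_iff cocycles_def unit_coLie_def)

lemma incl_axis_vec: "incl unit_coLie d i (axis_vec k) = (y_var k :: 'm mdeg \<Rightarrow>\<^sub>0 'k)"
proof -
  have "pm_scale (axis_vec k j) (y_var j) = (if j = k then y_var j else (0 :: 'm mdeg \<Rightarrow>\<^sub>0 'k))" for j
    by (rule poly_mapping_eqI) (simp add: axis_vec_def)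
  then show ?thesis by (simp add: unit_coLie_def)
qed

text \<open>
  A map of coLie-coalgebras may differ from its linear part by decomposables, but in multidegree
  \<open>unit_deg k\<close> there are none: the entries of the multidegree of a product of two letters add up to at
  least \<open>2\<close>.
\<close>

lemma unit_y_var: "\<Phi> (y_var k) = incl \<aa> (unit_deg k) (-1) (unit_vec k)"
proof -
  have "\<Phi> (incl unit_coLie (unit_deg k) (-1) (axis_vec k)) - incl \<aa> (unit_deg k) (-1) (unit_vec k)
      \<in> decomposables \<aa> (unit_deg k) (-1 + 1)"
    using unit_map axis_vec_letter unfolding coLie_map_def unit_vec_def by blast
  moreover have "decomposables \<aa> (unit_deg k) n \<subseteq> {0}" for n
    unfolding decomposables_eq
  proof (rule word_span_least)
    fix w assume "w \<in> words (und \<aa>)" "2 \<le> length w \<and> homogeneous (unit_deg k) n w"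
    moreover have "sum (unit_deg k :: 'm mdeg) UNIV = 1" by (simp add: unit_deg_def)
    ultimately show "pr w \<in> {0}" using length_le_word_mdeg[of w] by simp
  qed simp
  ultimately show ?thesis by (force simp: incl_axis_vec)
qed

lemma unit_y_var_sym_part: "\<Phi> (y_var k) \<in> sym_part \<aa> (unit_deg k) 0"
  using incl_sym_part[OF unit_vec_letter] by (simp add: unit_y_var)

lemma codif_unit_y_var: "codif \<aa> (\<Phi> (y_var k)) = 0"
proof -
  let ?U = "unit_coLie :: ('k, 'm, 'm \<Rightarrow> 'k, 'm mdeg \<Rightarrow>\<^sub>0 'k) coLie"
  interpret U: vector_space "smul ?U"
    by (simp add: unit_coLie_def vector_space_pm_scale)
  interpret \<Phi>: Vector_Spaces.linear "smul ?U" "smul \<aa>" \<Phi>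
    using unit_map by (simp add: coLie_map_def)
  have "word_prod (incl ?U) [(unit_deg k, -1, axis_vec k)] \<in> sym_part ?U (unit_deg k) 0"
    unfolding sym_part_def by (rule U.span_base, rule imageI) (simp add: axis_vec_letter)
  then have "y_var k \<in> obj (coChev_un ?U (unit_deg k)) 0"
    by (simp add: coChev_un_def incl_axis_vec)
  moreover have "chain_map (coChev_un ?U (unit_deg k)) (coChev_un \<aa> (unit_deg k)) (\<lambda>_. \<Phi>)"
    using unit_map by (simp add: coLie_map_def)
  ultimately have "\<Phi> (dif (coChev_un ?U (unit_deg k)) 0 (y_var k)) = dif (coChev_un \<aa> (unit_deg k)) 0 (\<Phi> (y_var k))"
    unfolding chain_map_def by blast
  then show ?thesis
    by (simp add: coChev_un_def unit_coLie_def)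
qed

lemma unit_y_var_regular: "\<Phi> (y_var k) * x = 0 \<Longrightarrow> x = 0"
proof -
  interpret Xd: cochain_complex "und \<aa> (unit_deg k)"
    by (rule is_cpx_cochain_complex[OF cpx[OF unit_deg_nonzero]])
  have "unit_vec k \<noteq> 0"
    using unit_vec_not_coboundary[of k] Xd.subspace_0[OF Xd.subspace_coboundaries] by metis
  then show "\<Phi> (y_var k) * x = 0 \<Longrightarrow> x = 0"
    using letter_degree_0_regular[OF unit_vec_letter] by (simp add: unit_y_var)
qed

lemma stabilization_cochain_map:
  "cochain_map (coChev_un \<aa> d) (coChev_un \<aa> (d + unit_deg k)) (stabilization \<Phi> k)"
proof unfold_locales
  have "\<Phi> (y_var k) * x \<in> sym_part \<aa> (d + unit_deg k) n" if "x \<in> sym_part \<aa> d n" for x n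
    using sym_part_mult[OF unit_y_var_sym_part that] by (simp add: add.commute)
  moreover have "codif \<aa> (\<Phi> (y_var k) * x) = \<Phi> (y_var k) * codif \<aa> x" for x
    using codif_leibniz[OF unit_y_var_sym_part] codif_unit_y_var by (simp add: koszul_sign_def)
  ultimately show "chain_map (coChev_un \<aa> d) (coChev_un \<aa> (d + unit_deg k)) (stabilization \<Phi> k)"
    by (auto simp: chain_map_def coChev_un_def stabilization_def linear_map_on_def distrib_left mult_scale)
qed (rule is_cpx_coChev_un)+

text \<open>
  Taking the unit vector itself as the representative of its class makes the homotopy vanish on \<open>y\<close>.
\<close>

lemma contraction_with_unit_exists:
  "\<exists>harm acyc \<sigma>. contracted_coLie \<aa> harm acyc \<sigma> \<and> unit_vec k \<in> harm (unit_deg k) (-1)"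
proof -
  have "\<exists>H A \<sigma>. d \<noteq> 0 \<longrightarrow> cochain_complex.contraction (und \<aa> d) H A \<sigma> \<and> (d = unit_deg k \<longrightarrow> unit_vec k \<in> H (-1))" for d
  proof (cases "d = 0")
    case False
    interpret Xd: cochain_complex "und \<aa> d" by (rule is_cpx_cochain_complex[OF cpx[OF False]])
    let ?K = "\<lambda>i :: int. Xd.span (if d = unit_deg k \<and> i = -1 then {unit_vec k} else {})"
    have "\<exists>H A \<sigma>. Xd.contraction H A \<sigma> \<and> (\<forall>i. ?K i \<subseteq> H i)"
    proof (rule Xd.contraction_exists)
      fix i
      show "Xd.subspace (?K i)" by (rule Xd.subspace_span)
      show "?K i \<subseteq> cocycles (und \<aa> d) i"
        by (rule Xd.span_minimal[OF _ Xd.subspace_cocycles]) (use unit_vec_cocycle in auto)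
      show "?K i \<inter> coboundaries (und \<aa> d) i \<subseteq> {0}"
      proof
        fix x assume x: "x \<in> ?K i \<inter> coboundaries (und \<aa> d) i"
        show "x \<in> {0}"
        proof (cases "d = unit_deg k \<and> i = -1")
          case True
          from x have "x \<in> Xd.span {unit_vec k}"
            unfolding if_P[OF True] by blast
          then obtain c where c: "x = scl (und \<aa> d) c (unit_vec k)"
            unfolding Xd.span_singleton by blast
          have "c = 0"
          proof (rule ccontr)
            assume "c \<noteq> 0"
            then have "unit_vec k = scl (und \<aa> d) (1 / c) x" by (simp add: c)
            then have "unit_vec k \<in> coboundaries (und \<aa> d) i"
              using x Xd.subspace_scale[OF Xd.subspace_coboundaries] by simp
            then show False using True unit_vec_not_coboundary by simp
          qed
          then show ?thesis by (simp add: c)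
        next
          case False
          from x have "x \<in> Xd.span {}"
            unfolding if_not_P[OF False] by blast
          then show ?thesis by simp
        qed
      qed
    qed
    then obtain H A \<sigma> where H: "Xd.contraction H A \<sigma>" "\<And>i. ?K i \<subseteq> H i" by blast
    have "unit_vec k \<in> H (-1)" if "d = unit_deg k"
      using H(2)[of "-1"] Xd.span_base[of "unit_vec k" "{unit_vec k}"] that by auto
    then show ?thesis using H(1) by blast
  qed simp
  then obtain harm acyc \<sigma> where *: "\<And>d. d \<noteq> 0 \<Longrightarrow> cochain_complex.contraction (und \<aa> d) (harm d) (acyc d) (\<sigma> d)"
    "unit_vec k \<in> harm (unit_deg k) (-1)"
    using unit_deg_nonzero by metis
  then have "contracted_coLie \<aa> harm acyc \<sigma>"
    by unfold_locales
  then show ?thesis using *(2) by blast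
qed

text \<open>
  The unit lives in degree \<open>-1\<close> only, so in degrees \<open>\<ge> 0\<close> it adds no coboundaries to the mapping cone.
\<close>

lemma Quot_un_class_nonzero:
  assumes d: "d \<noteq> 0" and i: "0 \<le> i" and v: "v \<in> cocycles (und \<aa> d) i" "v \<notin> coboundaries (und \<aa> d) i"
  shows "\<exists>V\<in>coh (Quot_un \<aa> \<eta> d) i. V \<noteq> coboundaries (Quot_un \<aa> \<eta> d) i"
proof -
  interpret \<eta>: cochain_map "unit_cpx d" "und \<aa> d" "\<eta> d" by (rule unit_cochain_map[OF d])
  let ?Q = "Quot_un \<aa> \<eta> d"
  have Q: "?Q = map_cone (unit_cpx d) (und \<aa> d) (\<eta> d)"
    by (simp add: Quot_un_def unit_coLie_def)
  have cocycle: "(0, v) \<in> cocycles ?Q i"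
    using v(1) by (auto simp: Q cocycles_def map_cone_def zero_prod_def)
  have not_bd: "(0, v) \<notin> coboundaries ?Q i"
  proof
    assume "(0, v) \<in> coboundaries ?Q i"
    then obtain x y where "x \<in> obj (unit_cpx d) i" and y: "y \<in> obj (und \<aa> d) (i - 1)"
      and eq: "v = \<eta> d i x + dif (und \<aa> d) (i - 1) y"
      by (auto simp: Q coboundaries_def map_cone_def)
    then have "x = 0" using i by (simp add: unit_cpx_def)
    then have "v \<in> coboundaries (und \<aa> d) i" using eq y by (auto simp: coboundaries_def)
    then show False using v(2) by simp
  qed
  have "0 \<in> coboundaries ?Q i"
    unfolding coboundaries_def
    by (rule image_eqI[of _ _ "(0, 0)"]) (simp_all add: Q map_cone_def zero_prod_def)
  then have "(0, v) \<in> coh_rel ?Q i `` {(0, v)}"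
    using cocycle by (simp add: coh_rel_def zero_prod_def)
  then have "coh_rel ?Q i `` {(0, v)} \<noteq> coboundaries ?Q i" using not_bd by blast
  moreover have "coh_rel ?Q i `` {(0, v)} \<in> coh ?Q i"
    unfolding coh_def by (rule quotientI[OF cocycle])
  ultimately show ?thesis by (rule bexI)
qed

text \<open>
  In a word of representatives without the factor \<open>y\<close>, the cohomological degree of every letter is
  nonnegative, hence at most \<open>n\<close>, so the bound on the quotient applies to each letter that is not itself
  one of the variables.  Adding up, the inequality would hold for the whole word, but multidegree
  \<open>unit_deg k + d\<close> violates it by at least one.
\<close>

lemma harmonic_word_in_y_multiples:
  fixes c\<^sub>0 s :: nat and t :: "'m \<Rightarrow> nat"
  assumes bound: "\<And>i d V. d \<noteq> 0 \<Longrightarrow> V \<in> coh (Quot_un \<aa> \<eta> d) i \<Longrightarrow> V \<noteq> coboundaries (Quot_un \<aa> \<eta> d) i \<Longrightarrow>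
      i \<le> int c\<^sub>0 \<Longrightarrow> int (d k) \<le> int s * (i + 1) + (\<Sum>j\<in>UNIV - {k}. int (t j) * int (d j))"
    and contracted: "contracted_coLie \<aa> harm acyc \<sigma>" and unit_harm: "unit_vec k \<in> harm (unit_deg k) (-1)"
    and w: "\<forall>l\<in>set w. contracted_coLie.harmonic_letter harm l" "word_mdeg w = unit_deg k + d" "word_cdeg w = n"
    and n: "n \<le> int c\<^sub>0" and d: "int (d k) \<ge> int s * n + (\<Sum>j\<in>UNIV - {k}. int (t j) * int (d j))"
  shows "\<exists>a\<in>sym_part \<aa> d n. pr w = incl \<aa> (unit_deg k) (-1) (unit_vec k) * a"
proof -
  interpret contracted_coLie \<aa> harm acyc \<sigma> by (rule contracted)
  let ?y = "incl \<aa> (unit_deg k) (-1) (unit_vec k)"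
  let ?B = "\<lambda>n e. int (e k) \<le> int s * n + (\<Sum>j\<in>UNIV - {k}. int (t j) * int (e j))"
  have w_words: "w \<in> words (und \<aa>)"
    using w(1) harmonic_letter_letters by (auto simp: words_def)
  consider (zero) e i where "(e, i, 0) \<in> set w"
    | (unit) v where "(unit_deg k, -1, v) \<in> set w"
    | (other) "\<And>e i v. (e, i, v) \<in> set w \<Longrightarrow> v \<noteq> 0 \<and> \<not> (e = unit_deg k \<and> i = -1)"
    by blast
  then show ?thesis
  proof cases
    case zero
    then obtain w1 w2 where split: "w = w1 @ (e, i, 0) # w2" by (auto simp: in_set_conv_decomp)
    then have "e \<noteq> 0" using w_words by (simp add: letters_iff)
    then have "pr w = ?y * 0" by (simp add: split incl_0)
    then show ?thesis using subspace_0[OF subspace_sym_part] by blast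
  next
    case unit
    then obtain w1 w2 where split: "w = w1 @ (unit_deg k, -1, v) # w2" by (auto simp: in_set_conv_decomp)
    have v: "v \<in> harm (unit_deg k) (-1)" using w(1) unit by (auto simp: harmonic_letter_def)
    interpret Xd: cochain_complex "und \<aa> (unit_deg k)"
      by (rule is_cpx_cochain_complex[OF cpx[OF unit_deg_nonzero]])
    have H: "Xd.subspace (harm (unit_deg k) (-1))" "harm (unit_deg k) (-1) \<inter> coboundaries (und \<aa> (unit_deg k)) (-1) \<subseteq> {0}"
      using contraction[OF unit_deg_nonzero[of k]] unfolding Xd.contraction_def by blast+
    have "\<exists>c. v = scl (und \<aa> (unit_deg k)) c (unit_vec k)"
    proof (cases "v \<in> coboundaries (und \<aa> (unit_deg k)) (-1)")
      case True
      then have "v = 0" using v H(2) by blast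
      then show ?thesis by (intro exI[of _ 0]) simp
    next
      case False
      have "v \<in> cocycles (und \<aa> (unit_deg k)) (-1)" using v harm_cocycles[OF unit_deg_nonzero] by blast
      from cocycle_degree_minus_1[OF unit_deg_nonzero this False]
      obtain c where c: "v - scl (und \<aa> (unit_deg k)) c (unit_vec k) \<in> coboundaries (und \<aa> (unit_deg k)) (-1)"
        by (auto simp: unit_deg_eq_iff)
      moreover have "v - scl (und \<aa> (unit_deg k)) c (unit_vec k) \<in> harm (unit_deg k) (-1)"
        using v unit_harm H(1) Xd.subspace_diff Xd.subspace_scale by blast
      ultimately have "v - scl (und \<aa> (unit_deg k)) c (unit_vec k) = 0" using H(2) by blast
      then show ?thesis by (intro exI[of _ c]) simp
    qed
    then obtain c where "v = scl (und \<aa> (unit_deg k)) c (unit_vec k)" by blast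
    then have c: "incl \<aa> (unit_deg k) (-1) v = smul \<aa> c ?y"
      using incl_scale[OF unit_vec_letter] by simp
    let ?a = "smul \<aa> c (pr (w1 @ w2))"
    have "pr w = smul \<aa> c ((pr w1 * ?y) * pr w2)"
      by (simp add: split c mult_scale mult.assoc flip: scale_mult)
    also have "pr w1 * ?y = ?y * pr w1"
      by (rule letter_degree_0_central[OF unit_vec_letter, symmetric])
    also have "smul \<aa> c (?y * pr w1 * pr w2) = ?y * ?a"
      by (simp add: mult_scale mult.assoc)
    finally have "pr w = ?y * ?a" .
    moreover have "homogeneous d n (w1 @ w2)"
    proof
      have "unit_deg k + word_mdeg (w1 @ w2) = unit_deg k + d"
        using w(2) by (simp add: split ac_simps)
      then show "word_mdeg (w1 @ w2) = d" by (rule add_left_imp_eq)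
      show "word_cdeg (w1 @ w2) = n" using w(3) by (simp add: split)
    qed
    then have "?a \<in> sym_part \<aa> d n"
      using w_words by (intro subspace_scale[OF subspace_sym_part]) 
        (auto simp only: sym_part_eq split words_append words_Cons intro!: word_span_base)
    ultimately show ?thesis by blast
  next
    case other
    \<comment> \<open>The letter \<open>(e, i, v)\<close> contributes \<open>i + 1\<close> to the cohomological degree of the word.\<close>
    have letter: "0 \<le> i + 1 \<and> (i \<le> int c\<^sub>0 \<longrightarrow> ?B (i + 1) e)" if l: "(e, i, v) \<in> set w" for e i v
    proof -
      have e: "e \<noteq> 0" and v: "v \<in> harm e i" using w(1) l by (auto simp: harmonic_letter_def)
      interpret Xd: cochain_complex "und \<aa> e" by (rule is_cpx_cochain_complex[OF cpx[OF e]])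
      have vZ: "v \<in> cocycles (und \<aa> e) i" using v harm_cocycles[OF e] by blast
      have "harm e i \<inter> coboundaries (und \<aa> e) i \<subseteq> {0}"
        using contraction[OF e] unfolding Xd.contraction_def by blast
      then have vB: "v \<notin> coboundaries (und \<aa> e) i" using v other[OF l] by blast
      have "\<not> i < -1"
      proof
        assume "i < -1"
        then have "coh (und \<aa> e) i = {coboundaries (und \<aa> e) i}"
          using strong e by (simp add: strongly_unital_def)
        then show False using Xd.coh_eq_0D vZ vB by blast
      qed
      then consider "i = -1" | "0 \<le> i" by linarith
      then show ?thesis
      proof cases
        case 1
        then obtain j where "e = unit_deg j"
          using cocycle_degree_minus_1[OF e] vZ vB by blast
        then have "e k = 0" using other[OF l] 1 by (auto simp: unit_deg_def)
        then show ?thesis using 1 by (simp add: sum_nonneg)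
      next
        case 2
        from Quot_un_class_nonzero[OF e 2 vZ vB] show ?thesis using bound[OF e] 2 by auto
      qed
    qed
    have "0 \<le> word_cdeg u \<and> (word_cdeg u \<le> int c\<^sub>0 \<longrightarrow> ?B (word_cdeg u) (word_mdeg u))"
      if "set u \<subseteq> set w" for u
      using that
    proof (induction u)
      case (Cons l u)
      obtain e i v where l: "l = (e, i, v)" by (cases l)
      have *: "0 \<le> i + 1 \<and> (i \<le> int c\<^sub>0 \<longrightarrow> ?B (i + 1) e)" using letter[of e i v] Cons.prems l by simp
      have IH: "0 \<le> word_cdeg u \<and> (word_cdeg u \<le> int c\<^sub>0 \<longrightarrow> ?B (word_cdeg u) (word_mdeg u))"
        using Cons by simp
      show ?case
        using * IH by (auto simp: l distrib_left sum.distrib)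
    qed simp
    from this[of w] have "?B n (unit_deg k + d)" using w n by simp
    moreover have "(\<Sum>j\<in>UNIV - {k}. int (t j) * int ((unit_deg k + d) j)) = (\<Sum>j\<in>UNIV - {k}. int (t j) * int (d j))"
      by (rule sum.cong) (auto simp: unit_deg_def)
    ultimately have False using d by (simp add: unit_deg_def)
    then show ?thesis ..
  qed
qed

lemma cocycle_mod_y_is_boundary_mod_y_in_range:
  fixes c\<^sub>0 s :: nat and t :: "'m \<Rightarrow> nat"
  assumes bound: "\<And>i d V. d \<noteq> 0 \<Longrightarrow> V \<in> coh (Quot_un \<aa> \<eta> d) i \<Longrightarrow> V \<noteq> coboundaries (Quot_un \<aa> \<eta> d) i \<Longrightarrow>
      i \<le> int c\<^sub>0 \<Longrightarrow> int (d k) \<le> int s * (i + 1) + (\<Sum>j\<in>UNIV - {k}. int (t j) * int (d j))"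
    and n: "n \<le> int c\<^sub>0" and d: "int (d k) \<ge> int s * n + (\<Sum>j\<in>UNIV - {k}. int (t j) * int (d j))"
    and z: "z \<in> sym_part \<aa> (d + unit_deg k) n" "b \<in> sym_part \<aa> d (n + 1)" "codif \<aa> z = \<Phi> (y_var k) * b"
  shows "\<exists>a\<in>sym_part \<aa> d n. \<exists>x\<in>sym_part \<aa> (d + unit_deg k) (n - 1). z = \<Phi> (y_var k) * a + codif \<aa> x"
proof -
  obtain harm acyc \<sigma> where contracted: "contracted_coLie \<aa> harm acyc \<sigma>" and unit: "unit_vec k \<in> harm (unit_deg k) (-1)"
    using contraction_with_unit_exists by blast
  interpret contracted_coLie \<aa> harm acyc \<sigma> by (rule contracted)
  have "\<exists>a\<in>sym_part \<aa> d n. \<exists>x\<in>sym_part \<aa> (unit_deg k + d) (n - 1).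
      z = incl \<aa> (unit_deg k) (-1) (unit_vec k) * a + codif \<aa> x"
  proof (rule cocycle_mod_y_is_boundary_mod_y)
    show "harmonic_letter (unit_deg k, -1, unit_vec k)" using unit by (simp add: harmonic_letter_def)
    show "codif \<aa> (incl \<aa> (unit_deg k) (-1) (unit_vec k)) = 0"
      using codif_unit_y_var by (simp add: unit_y_var)
    show "\<exists>a\<in>sym_part \<aa> d n. pr w = incl \<aa> (unit_deg k) (-1) (unit_vec k) * a"
      if "\<forall>l\<in>set w. harmonic_letter l" "homogeneous (unit_deg k + d) n w" for w
      by (rule harmonic_word_in_y_multiples[OF bound contracted unit that(1) _ _ n d]) (use that(2) in auto)
  qed (use z in \<open>simp_all add: add.commute unit_y_var\<close>)
  then show ?thesis by (simp add: add.commute unit_y_var)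
qed

end

theorem theorem1p4p2:
  fixes \<aa> :: "('k::field_char_0, 'm::finite, 'v::ab_group_add, 'a::ring_1) coLie"
    and \<eta> :: "'m mdeg \<Rightarrow> int \<Rightarrow> ('m \<Rightarrow> 'k) \<Rightarrow> 'v"
    and \<Phi> :: "('m mdeg \<Rightarrow>\<^sub>0 'k) \<Rightarrow> 'a"
    and c\<^sub>0 s :: nat and k :: 'm and t :: "'m \<Rightarrow> nat"
  assumes "is_unital_coLie \<aa> \<eta> \<Phi>"
    and "strongly_unital \<aa> \<eta>"
    and "\<And>(c::int) (d::'m mdeg) v.
           d \<noteq> 0 \<Longrightarrow> v \<in> coh (Quot_un \<aa> \<eta> d) (c - 1) \<Longrightarrow>
           v \<noteq> coboundaries (Quot_un \<aa> \<eta> d) (c - 1) \<Longrightarrow> c - 1 \<le> int c\<^sub>0 \<Longrightarrow>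
           int (d k) \<le> int s * c + (\<Sum>i\<in>UNIV - {k}. int (t i) * int (d i))"
  shows "\<And>(c::int) (d::'m mdeg).
           c \<le> int c\<^sub>0 \<Longrightarrow> d \<noteq> 0 \<Longrightarrow>
           int (d k) \<ge> int s * c + (\<Sum>i\<in>UNIV - {k}. int (t i) * int (d i)) \<Longrightarrow>
           quasi_iso (trunc_le c (coChev_un \<aa> d)) (trunc_le c (coChev_un \<aa> (d + unit_deg k)))
             (stabilization \<Phi> k) \<and>
           inj_on (coh_map (coChev_un \<aa> (d + unit_deg k)) (stabilization \<Phi> k) (c + 1))
             (coh (coChev_un \<aa> d) (c + 1))"
proof -
  fix c :: int and d :: "'m mdeg"
  assume c: "c \<le> int c\<^sub>0" and d: "int (d k) \<ge> int s * c + (\<Sum>i\<in>UNIV - {k}. int (t i) * int (d i))"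
  interpret strongly_unital_coLie \<aa> \<eta> \<Phi>
    using assms(1,2) by unfold_locales (simp_all add: is_unital_coLie_def)
  interpret stab: cochain_map "coChev_un \<aa> d" "coChev_un \<aa> (d + unit_deg k)" "stabilization \<Phi> k"
    by (rule stabilization_cochain_map)
  have bound: "int (d k) \<le> int s * (i + 1) + (\<Sum>j\<in>UNIV - {k}. int (t j) * int (d j))"
    if "d \<noteq> 0" "V \<in> coh (Quot_un \<aa> \<eta> d) i" "V \<noteq> coboundaries (Quot_un \<aa> \<eta> d) i" "i \<le> int c\<^sub>0"
    for d :: "'m mdeg" and i V
    using assms(3)[of d V "i + 1"] that by simp
  have vanishing: "\<exists>a\<in>sym_part \<aa> d n. \<exists>x\<in>sym_part \<aa> (d + unit_deg k) (n - 1). z = \<Phi> (y_var k) * a + codif \<aa> x"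
    if "n \<le> c" "z \<in> sym_part \<aa> (d + unit_deg k) n" "b \<in> sym_part \<aa> d (n + 1)" "codif \<aa> z = \<Phi> (y_var k) * b"
    for n z b
  proof -
    have "int s * n \<le> int s * c" using \<open>n \<le> c\<close> by (simp add: mult_left_mono)
    then have "int (d k) \<ge> int s * n + (\<Sum>i\<in>UNIV - {k}. int (t i) * int (d i))" using d by linarith
    moreover have "n \<le> int c\<^sub>0" using \<open>n \<le> c\<close> c by simp
    ultimately show ?thesis
      by (intro cocycle_mod_y_is_boundary_mod_y_in_range[OF bound _ _ that(2-4)])
  qed
  interpret \<delta>: Vector_Spaces.linear "smul \<aa>" "smul \<aa>" "codif \<aa>" by (rule linear_codif)
  have \<delta>_y: "codif \<aa> (\<Phi> (y_var k) * a) = \<Phi> (y_var k) * codif \<aa> a" if "a \<in> sym_part \<aa> d n" for a n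
    using stab.map_dif[of a n] that by (simp add: coChev_un_def stabilization_def)
  \<comment> \<open>Vanishing in degree \<open>n\<close> gives surjectivity in degree \<open>n\<close> and injectivity in degree \<open>n + 1\<close>.\<close>
  have inj: "x \<in> coboundaries (coChev_un \<aa> d) i"
    if i: "i \<le> c + 1" and x: "x \<in> cocycles (coChev_un \<aa> d) i"
      "stabilization \<Phi> k i x \<in> coboundaries (coChev_un \<aa> (d + unit_deg k)) i" for i x
  proof -
    obtain z where z: "z \<in> sym_part \<aa> (d + unit_deg k) (i - 1)" "codif \<aa> z = \<Phi> (y_var k) * x"
      using x(2) by (auto simp: coboundaries_def coChev_un_def stabilization_def)
    have "x \<in> sym_part \<aa> d (i - 1 + 1)" using x(1) by (simp add: cocycles_def coChev_un_def)
    from vanishing[OF _ z(1) this z(2)] i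
    obtain a w where a: "a \<in> sym_part \<aa> d (i - 1)" "z = \<Phi> (y_var k) * a + codif \<aa> w" by auto
    then have "\<Phi> (y_var k) * (x - codif \<aa> a) = 0"
      using z(2) \<delta>_y[OF a(1)] by (simp add: \<delta>.add codif_codif right_diff_distrib)
    then have "x = codif \<aa> a" using unit_y_var_regular by fastforce
    then show ?thesis using a(1) by (auto simp: coboundaries_def coChev_un_def)
  qed
  have surj: "\<exists>x\<in>cocycles (coChev_un \<aa> d) i. z - stabilization \<Phi> k i x \<in> coboundaries (coChev_un \<aa> (d + unit_deg k)) i"
    if i: "i \<le> c" and z: "z \<in> cocycles (coChev_un \<aa> (d + unit_deg k)) i" for i z
  proof -
    have z': "z \<in> sym_part \<aa> (d + unit_deg k) i" "codif \<aa> z = \<Phi> (y_var k) * 0"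
      using z by (simp_all add: cocycles_def coChev_un_def)
    from vanishing[OF i z'(1) subspace_0[OF subspace_sym_part] z'(2)]
    obtain a w where a: "a \<in> sym_part \<aa> d i" "w \<in> sym_part \<aa> (d + unit_deg k) (i - 1)"
      "z = \<Phi> (y_var k) * a + codif \<aa> w" by auto
    then have "\<Phi> (y_var k) * codif \<aa> a = 0"
      using z'(2) \<delta>_y[OF a(1)] by (simp add: \<delta>.add codif_codif)
    then have "codif \<aa> a = 0" by (rule unit_y_var_regular)
    then show ?thesis
      using a by (intro bexI[of _ a]) (auto simp: cocycles_def coboundaries_def coChev_un_def stabilization_def)
  qed
  show "quasi_iso (trunc_le c (coChev_un \<aa> d)) (trunc_le c (coChev_un \<aa> (d + unit_deg k))) (stabilization \<Phi> k) \<and>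
      inj_on (coh_map (coChev_un \<aa> (d + unit_deg k)) (stabilization \<Phi> k) (c + 1)) (coh (coChev_un \<aa> d) (c + 1))"
    using stab.quasi_iso_trunc_le[OF inj surj] inj[of "c + 1"] by (auto simp: stab.inj_on_coh_map_iff)
qed

end
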